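(* Let $k$ be a nonzero real number, let $M\in \mathrm{PSL}(2,\mathbb{R})$ be fixed, and let $\mathcal{U}_M\subset \mathrm{PSL}(2,\mathbb{R})$ be the open set of all $W_0\in\mathrm{PSL}(2,\mathbb{R})$ such that the upper-left matrix entry of $m:=W_0^{-1}MW_0$ is nonzero. On $\mathcal{U}_M$ let $m_\pm$ be the smooth functions of $W_0$ given by the decomposition $m=m_-^{-1}m_+$ described in the context, let $\Omega_\bullet$ be the 2-form $$\Omega_\bullet=\frac{k}{4\pi}\,\mathrm{tr}\left(\delta W_0\,W_0^{-1}\,M\,\delta W_0\,W_0^{-1}\,M^{-1}+\delta m_+\,m_+^{-1}\,\delta m_-\,m_-^{-1}\right),$$ and, for $\sigma\in\mathfrak{sl}(2,\mathbb{R})$, let $\mathfrak{X}[\sigma]$ be the vector field on $\mathcal{U}_M$ defined by $\mathscr{L}_{\mathfrak{X}[\sigma]}W_0=\frac{2\pi}{k}W_0\sigma$. Let $\mathcal{Q}:=(m_-,m_+)$, a function on $\mathcal{U}_M$ with values in the group $\mathrm{PSL}(2,\mathbb{R})^*$ defined in the context. Then for every $\sigma\in\mathfrak{sl}(2,\mathbb{R})$, $$\imath_{\mathfrak{X}[\sigma]}\Omega_\bullet=-\mathrm{tr}\left(m_-^{-1}\delta m_-\,\sigma\right)+\mathrm{tr}\left(m_+^{-1}\delta m_+\,\sigma\right)=\left(-\mathcal{Q}^{-1}\delta\mathcal{Q}\right)[\sigma],$$ and $$\mathscr{L}_{\mathfrak{X}[\sigma]}\Omega_\bullet=\left(\ma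thcal{Q}^{-1}\delta\mathcal{Q}\,\mathcal{Q}^{-1}\delta\mathcal{Q}\right)[\sigma].$$
   Context: $\delta$ denotes the exterior derivative on $\mathcal{U}_M$ (so $\delta M=0$), $\imath$ the interior product, $\mathscr{L}$ the Lie derivative; products of matrix-valued 1-forms are wedge products combined with matrix multiplication, with $\imath_{\mathfrak{X}}(\alpha\beta)=(\imath_{\mathfrak{X}}\alpha)\beta-\alpha(\imath_{\mathfrak{X}}\beta)$ for 1-forms $\alpha,\beta$. The trace is normalized so that $\mathrm{tr}$ of the $2\times2$ identity matrix is $1$ (half the usual trace). $\Omega_\bullet$ is a closed 2-form (a known fact). Decomposition. An element $m\in\mathrm{PSL}(2,\mathbb{R})=\mathrm{SL}(2,\mathbb{R})/\{\pm1\}$ with nonzero upper-left entry is represented by a matrix whose upper-left entry is negative, and this matrix is uniquely written as $$m=\begin{pmatrix}-m_{\mathrm K}^2&-m_{\mathrm K}m_{\mathrm f}\\ m_{\mathrm e}m_{\mathrm K}&m_{\mathrm e}m_{\mathrm f}-m_{\mathrm K}^{-2}\end{pmatrix},\qquad m_{\mathrm K}>0,\ m_{\mathrm e},m_{\mathrm f}\in\mathbb{R}.$$ Set $$m_-:=-\begin{pmatrix}m_{\mathrm K}^{-1}&0\\ m_{\mathrm e}&m_{\mathrm K}\end{pmatrix},\qquad m_+:=\begin{pmatrix}m_{\mathrm K}&m_{\mathrm f}\\0&m_{\mathrm K}^{-1}\end{pmatrix},$$ so that $m=m_-^{-1}m_+$. The group $\mathrm{PSL}(2,\mathbb{R})^*\subset\mathrm{PSL}(2,\mathbb{R})\times\mathrm{PSL}(2,\mathbb{R})$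 is the subgroup of all pairs $(m_-,m_+)$ of the form $$\left(-\begin{pmatrix}m_{\mathrm K}^{-1}&0\\ m_{\mathrm e}&m_{\mathrm K}\end{pmatrix},\ \begin{pmatrix}m_{\mathrm K}&m_{\mathrm f}\\0&m_{\mathrm K}^{-1}\end{pmatrix}\right),\qquad m_{\mathrm K}>0,\ m_{\mathrm e},m_{\mathrm f}\in\mathbb{R}.$$ Its Lie algebra $\mathfrak{sl}(2,\mathbb{R})^*$ consists of pairs $\chi=(\chi_-,\chi_+)$ of traceless real matrices, with $\chi_-$ lower triangular, $\chi_+$ upper triangular and opposite diagonal parts. It is paired with $\mathfrak{sl}(2,\mathbb{R})$ by $\chi[\sigma]:=-\mathrm{tr}\left((\chi_+-\chi_-)\sigma\right)$; the same formula is applied to differential forms with values in $\mathfrak{sl}(2,\mathbb{R})^*$. Group operations are componentwise: $\mathcal{Q}^{-1}\delta\mathcal{Q}=(m_-^{-1}\delta m_-,\,m_+^{-1}\delta m_+)$, and $\mathcal{Q}^{-1}\delta\mathcal{Q}\,\mathcal{Q}^{-1}\delta\mathcal{Q}$ is the componentwise product of this matrix-valued 1-form with itself. *)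

theory Defs
  imports "HOL-Analysis.Analysis" "HOL-Algebra.Coset"
begin

type_synonym mat2 = "real^2^2"

definition mk :: "real \<Rightarrow> real \<Rightarrow> real \<Rightarrow> real \<Rightarrow> mat2" where
  "mk a b c d = vector [vector [a, b], vector [c, d]]"

text \<open>The normalized trace: \<open>tr\<close> of the identity matrix is 1.\<close>

definition tr :: "mat2 \<Rightarrow> real" where
  "tr A = trace A / 2"


section \<open>The groups\<close>

definition SL2 :: "mat2 monoid" where
  "SL2 = \<lparr>carrier = {A. det A = 1}, mult = (**), one = mat 1\<rparr>"

definition PSL2 :: "mat2 set monoid" where
  "PSL2 = SL2 Mod {mat 1, - mat 1}"

text \<open>The projection \<open>SL(2,\<real>) \<rightarrow> PSL(2,\<real>)\<close>; an element of \<open>PSL(2,\<real>)\<close> is a set \<open>{W, -W}\<close>.\<close>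

definition psl :: "mat2 \<Rightarrow> mat2 set" where
  "psl W = {mat 1, - mat 1} #>\<^bsub>SL2\<^esub> W"

definition sl2 :: "mat2 set" where
  "sl2 = {A. trace A = 0}"

definition psl_open :: "mat2 set set \<Rightarrow> bool" where
  "psl_open N \<longleftrightarrow> N \<subseteq> carrier PSL2 \<and> openin (top_of_set (carrier SL2)) {W \<in> carrier SL2. psl W \<in> N}"


section \<open>Differential calculus on PSL(2,R)\<close>

text \<open>
  The projection from \<open>SL(2,\<real>)\<close> to \<open>PSL(2,\<real>)\<close> is a two-fold covering, and \<open>SL(2,\<real>)\<close> is a
  submanifold of the space of matrices. The tangent space of \<open>SL(2,\<real>)\<close> at \<open>W\<close> is
  \<open>{W \<xi> | \<xi> \<in> sl2}\<close>, and the deck transformation \<open>W \<mapsto> -W\<close> sends the tangent vector \<open>W \<xi>\<close> at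
  \<open>W\<close> to \<open>(-W) \<xi>\<close> at \<open>-W\<close>. So a tangent vector of \<open>PSL(2,\<real>)\<close> at \<open>p\<close> is encoded by the
  element \<open>\<xi>\<close> of \<open>sl2\<close> for which it is the class of \<open>W \<xi>\<close>, for either \<open>W \<in> p\<close>.
  With this encoding

  \<^item> a vector field is a function from points to \<open>sl2\<close>;
  \<^item> a 1-form takes a point and an element of \<open>sl2\<close>, a 2-form a point and two elements of \<open>sl2\<close>.
    Values of forms at arguments outside \<open>sl2\<close> are irrelevant.
\<close>

type_synonym 'b form1 = "mat2 set \<Rightarrow> mat2 \<Rightarrow> 'b"
type_synonym 'b form2 = "mat2 set \<Rightarrow> mat2 \<Rightarrow> mat2 \<Rightarrow> 'b"

definition rep :: "mat2 set \<Rightarrow> mat2" where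
  "rep p = (SOME W. W \<in> p)"

text \<open>
  Exterior derivative of a vector-valued function. Derivatives within \<open>SL(2,\<real>)\<close> are unique only
  in the tangent directions \<open>W \<xi>\<close>, the only ones used.
\<close>

definition ext_d :: "(mat2 set \<Rightarrow> 'b::real_normed_vector) \<Rightarrow> 'b form1" where
  "ext_d f p \<xi> =
     frechet_derivative (\<lambda>W. f (psl W)) (at (rep p) within carrier SL2) (rep p ** \<xi>)"

text \<open>
  \<open>A\<close> is the tangent map at \<open>p\<close> of \<open>g : PSL(2,\<real>) \<rightarrow> PSL(2,\<real>)\<close>, computed with a local lift
  \<open>h\<close> of \<open>g\<close> to \<open>SL(2,\<real>)\<close>.
\<close>

definition has_tangent_map :: "(mat2 set \<Rightarrow> mat2 set) \<Rightarrow> (mat2 \<Rightarrow> mat2) \<Rightarrow> mat2 set \<Rightarrow> bool" where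
  "has_tangent_map g A p \<longleftrightarrow>
     (\<exists>W\<in>p. \<exists>h D. (h has_derivative D) (at W within carrier SL2) \<and>
        h W \<in> g p \<and> (\<forall>\<^sub>F W' in at W within carrier SL2. h W' \<in> g (psl W')) \<and>
        (\<forall>\<xi>\<in>sl2. D (W ** \<xi>) = h W ** A \<xi>))"

text \<open>
  In this encoding the value at \<open>\<xi>\<close> of the \<open>sl2\<close>-valued 1-form \<open>g\<^sup>-\<^sup>1 \<delta>g\<close> is the image of \<open>\<xi>\<close> under
  the tangent map of \<open>g\<close>; the form \<open>\<delta>g g\<^sup>-\<^sup>1\<close> is obtained from it by conjugation with \<open>g\<close>. Finally
  \<open>\<delta>g = G (g\<^sup>-\<^sup>1 \<delta>g)\<close>, where \<open>G \<in> g p\<close> selects the local lift of \<open>g\<close>: \<open>\<delta>g\<close> is a matrix-valued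
  form up to sign only.
\<close>

definition left_log :: "(mat2 set \<Rightarrow> mat2 set) \<Rightarrow> mat2 form1" where
  "left_log g p \<xi> = (THE \<eta>. \<exists>A. has_tangent_map g A p \<and> A \<xi> = \<eta>)"

definition right_log :: "(mat2 set \<Rightarrow> mat2 set) \<Rightarrow> mat2 form1" where
  "right_log g p \<xi> = rep (g p) ** left_log g p \<xi> ** matrix_inv (rep (g p))"

definition delta_lift :: "(mat2 set \<Rightarrow> mat2 set) \<Rightarrow> mat2 \<Rightarrow> mat2 form1" where
  "delta_lift g G p \<xi> = G ** left_log g p \<xi>"

text \<open>
  The product of matrix-valued 1-forms, with the convention
  \<open>\<iota>\<^sub>X (\<alpha> \<beta>) = (\<iota>\<^sub>X \<alpha>) \<beta> - \<alpha> (\<iota>\<^sub>X \<beta>)\<close>.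
\<close>

definition wedge :: "mat2 form1 \<Rightarrow> mat2 form1 \<Rightarrow> mat2 form2" where
  "wedge \<alpha> \<beta> p \<xi> \<eta> = \<alpha> p \<xi> ** \<beta> p \<eta> - \<alpha> p \<eta> ** \<beta> p \<xi>"

definition interior2 :: "(mat2 set \<Rightarrow> mat2) \<Rightarrow> 'b form2 \<Rightarrow> 'b form1" where
  "interior2 X \<omega> p \<xi> = \<omega> p (X p) \<xi>"

text \<open>The curve \<open>c\<close> in \<open>PSL(2,\<real>)\<close> has velocity \<open>\<xi>\<close> at time \<open>t\<close>.\<close>

definition has_velocity :: "(real \<Rightarrow> mat2 set) \<Rightarrow> mat2 \<Rightarrow> real \<Rightarrow> bool" where
  "has_velocity c \<xi> t \<longleftrightarrow>
     (\<exists>h. (\<forall>\<^sub>F s in nhds t. h s \<in> c s) \<and> (h has_vector_derivative (h t ** \<xi>)) (at t))"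

text \<open>\<open>\<phi>\<close> is a local flow, defined on \<open>(-\<epsilon>,\<epsilon>) \<times> N\<close>, of the vector field \<open>X\<close> on \<open>U\<close>.\<close>

definition local_flow ::
  "mat2 set set \<Rightarrow> (mat2 set \<Rightarrow> mat2) \<Rightarrow> real \<Rightarrow> mat2 set set \<Rightarrow> (real \<Rightarrow> mat2 set \<Rightarrow> mat2 set) \<Rightarrow> bool" where
  "local_flow U X \<epsilon> N \<phi> \<longleftrightarrow>
     (\<forall>q\<in>N. \<phi> 0 q = q \<and>
        (\<forall>t. \<bar>t\<bar> < \<epsilon> \<longrightarrow> \<phi> t q \<in> U \<and> has_velocity (\<lambda>s. \<phi> s q) (X (\<phi> t q)) t))"

text \<open>
  \<open>L\<close> is the value at \<open>p\<close> of the Lie derivative of \<open>\<omega>\<close> along \<open>X\<close>, that is, the derivative at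
  \<open>t = 0\<close> of the pullback of \<open>\<omega>\<close> by the time-\<open>t\<close> local flow of \<open>X\<close>.
\<close>

definition has_lie_derivative2 ::
  "mat2 set set \<Rightarrow> (mat2 set \<Rightarrow> mat2) \<Rightarrow> real form2 \<Rightarrow> mat2 set \<Rightarrow> (mat2 \<Rightarrow> mat2 \<Rightarrow> real) \<Rightarrow> bool" where
  "has_lie_derivative2 U X \<omega> p L \<longleftrightarrow>
     (\<exists>\<epsilon> N \<phi> A. \<epsilon> > 0 \<and> psl_open N \<and> p \<in> N \<and> local_flow U X \<epsilon> N \<phi> \<and>
        (\<forall>t. \<bar>t\<bar> < \<epsilon> \<longrightarrow> has_tangent_map (\<phi> t) (A t) p) \<and>
        (\<forall>\<xi>\<in>sl2. \<forall>\<eta>\<in>sl2.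
           ((\<lambda>t. \<omega> (\<phi> t p) (A t \<xi>) (A t \<eta>)) has_real_derivative L \<xi> \<eta>) (at 0)))"


section \<open>The decomposition\<close>

text \<open>Below, a point \<open>p\<close> of \<open>PSL(2,\<real>)\<close> plays the role of \<open>W\<^sub>0\<close>.\<close>

definition monodromy :: "mat2 set \<Rightarrow> mat2 set \<Rightarrow> mat2 set" where
  "monodromy M p = inv\<^bsub>PSL2\<^esub> p \<otimes>\<^bsub>PSL2\<^esub> M \<otimes>\<^bsub>PSL2\<^esub> p"

definition U_dom :: "mat2 set \<Rightarrow> mat2 set set" where
  "U_dom M = {p \<in> carrier PSL2. \<forall>A\<in>monodromy M p. A $ 1 $ 1 \<noteq> 0}"

definition decomp :: "real \<Rightarrow> real \<Rightarrow> real \<Rightarrow> mat2" where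
  "decomp K e f = mk (- K\<^sup>2) (- K * f) (e * K) (e * f - inverse (K\<^sup>2))"

definition minus_mat :: "real \<Rightarrow> real \<Rightarrow> mat2" where
  "minus_mat K e = - mk (inverse K) 0 e K"

definition plus_mat :: "real \<Rightarrow> real \<Rightarrow> mat2" where
  "plus_mat K f = mk K f 0 (inverse K)"

definition coords :: "mat2 set \<Rightarrow> real \<times> real \<times> real" where
  "coords m = (THE (K, e, f). K > 0 \<and> decomp K e f \<in> m)"

definition m_minus :: "mat2 set \<Rightarrow> mat2 set \<Rightarrow> mat2" where
  "m_minus M p = (case coords (monodromy M p) of (K, e, f) \<Rightarrow> minus_mat K e)"

definition m_plus :: "mat2 set \<Rightarrow> mat2 set \<Rightarrow> mat2" where
  "m_plus M p = (case coords (monodromy M p) of (K, e, f) \<Rightarrow> plus_mat K f)"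

lemma mat2_eqI:
  fixes A B :: mat2
  assumes "A $ 1 $ 1 = B $ 1 $ 1" "A $ 1 $ 2 = B $ 1 $ 2" "A $ 2 $ 1 = B $ 2 $ 1" "A $ 2 $ 2 = B $ 2 $ 2"
  shows "A = B"
  using assms by (simp add: vec_eq_iff forall_2)

lemma mk_nth [simp]:
  "mk a b c d $ 1 $ 1 = a" "mk a b c d $ 1 $ 2 = b" "mk a b c d $ 2 $ 1 = c" "mk a b c d $ 2 $ 2 = d"
  by (simp_all add: mk_def)

lemma matrix_mult_nth2: "((A::mat2) ** B) $ i $ j = A $ i $ 1 * B $ 1 $ j + A $ i $ 2 * B $ 2 $ j"
  by (simp add: matrix_matrix_mult_def sum_2)

text \<open>The factorization \<open>m = m\<^sub>-\<^sup>-\<^sup>1 m\<^sub>+\<close>.\<close>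

lemma minus_mat_decomp: "K > 0 \<Longrightarrow> minus_mat K e ** decomp K e f = plus_mat K f"
  by (rule mat2_eqI)
    (simp_all add: minus_mat_def plus_mat_def decomp_def matrix_mult_nth2 field_simps power2_eq_square)

lemma psl_eq: "psl W = {W, - W}"
proof -
  have "- mat 1 ** W = - W"
    by (rule mat2_eqI) (simp_all add: matrix_mult_nth2 mat_def)
  then show ?thesis by (auto simp: psl_def r_coset_def SL2_def)
qed

lemma decomp_unique:
  assumes "m \<in> carrier PSL2" and nz: "\<forall>A\<in>m. A $ 1 $ 1 \<noteq> 0"
  shows "\<exists>!(K, e, f). K > 0 \<and> decomp K e f \<in> m"
proof -
  obtain A where A: "det A = 1" and m: "m = {A, - A}"
    using assms(1) psl_eq
    by (auto simp: PSL2_def carrier_FactGroup SL2_def[symmetric] psl_def[symmetric])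
       (auto simp: SL2_def)
  define B where "B = (if A $ 1 $ 1 < 0 then A else - A)"
  have B: "B $ 1 $ 1 < 0" "B \<in> m" and BA: "m = {B, - B}"
    using nz m by (auto simp: B_def)
  have detB: "B $ 1 $ 1 * B $ 2 $ 2 - B $ 1 $ 2 * B $ 2 $ 1 = 1"
    using A by (auto simp: B_def det_2)
  have iff: "decomp K e f \<in> m \<longleftrightarrow> decomp K e f = B" if "K > 0" for K e f
  proof -
    have "decomp K e f \<noteq> - B"
    proof
      assume "decomp K e f = - B"
      then have "(decomp K e f) $ 1 $ 1 = - (B $ 1 $ 1)" by simp
      then show False using B(1) zero_le_power2[of K] by (simp add: decomp_def del: zero_le_power2)
    qed
    then show ?thesis using BA by auto
  qed
  define K where "K = sqrt (- B $ 1 $ 1)"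
  define f where "f = - B $ 1 $ 2 / K"
  define e where "e = B $ 2 $ 1 / K"
  have K: "K > 0" "K\<^sup>2 = - B $ 1 $ 1" using B(1) by (auto simp: K_def)
  have 22: "e * f - inverse (K\<^sup>2) = B $ 2 $ 2"
  proof -
    have "e * f = - (B $ 1 $ 2 * B $ 2 $ 1) / K\<^sup>2"
      by (simp add: e_def f_def power2_eq_square)
    then show ?thesis using detB B(1) K(2) by (simp add: field_simps)
  qed
  have dB: "decomp K e f = B"
    by (rule mat2_eqI) (use K 22 in \<open>simp_all add: decomp_def e_def f_def\<close>)
  show ?thesis
  proof (rule ex1I[of _ "(K, e, f)"])
    show "case (K, e, f) of (K, e, f) \<Rightarrow> K > 0 \<and> decomp K e f \<in> m"
      using dB K(1) B(2) by simp
  next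
    fix x assume x: "case x of (K, e, f) \<Rightarrow> K > 0 \<and> decomp K e f \<in> m"
    obtain K' e' f' where x': "x = (K', e', f')" by (cases x)
    have K': "K' > 0" and d: "decomp K' e' f' = decomp K e f"
      using x iff dB by (auto simp: x')
    have "K'\<^sup>2 = K\<^sup>2" "K' * f' = K * f" "e' * K' = e * K"
      using arg_cong[OF d, of "\<lambda>A. A $ 1 $ 1"] arg_cong[OF d, of "\<lambda>A. A $ 1 $ 2"]
        arg_cong[OF d, of "\<lambda>A. A $ 2 $ 1"] by (auto simp: decomp_def)
    moreover from this K' K(1) have "K' = K" by (simp add: power2_eq_iff_nonneg)
    ultimately show "x = (K, e, f)" using K(1) by (simp add: x')
  qed
qed

lemma group_SL2: "group SL2"
proof (rule groupI)
  fix A assume A: "A \<in> carrier SL2"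
  then have "det A \<noteq> 0" by (simp add: SL2_def)
  then have inv: "invertible A" by (simp add: invertible_det_nz)
  then obtain B where B: "B ** A = mat 1" by (auto simp: invertible_def)
  then have "det B * det A = 1" by (metis det_mul det_I)
  with A B show "\<exists>B\<in>carrier SL2. B \<otimes>\<^bsub>SL2\<^esub> A = \<one>\<^bsub>SL2\<^esub>"
    by (intro bexI[of _ B]) (auto simp: SL2_def)
qed (auto simp: SL2_def det_mul matrix_mul_assoc)

lemma minus_mat_1_mult: "- mat 1 ** W = - W" "W ** - mat 1 = - W" for W :: mat2
  by (rule mat2_eqI; simp add: matrix_mult_nth2 mat_def)+

lemma det_minus_mat_1: "det (- mat 1 :: mat2) = 1"
  by (simp add: det_2 mat_def)

lemma normal_SL2: "{mat 1, - mat 1} \<lhd> SL2"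
proof -
  interpret group SL2 by (rule group_SL2)
  have "subgroup {mat 1, - mat 1} SL2"
  proof (rule subgroupI)
    fix a assume a: "a \<in> {mat 1, - mat 1 :: mat2}"
    then have "a \<otimes>\<^bsub>SL2\<^esub> a = \<one>\<^bsub>SL2\<^esub>" "a \<in> carrier SL2"
      by (auto simp: SL2_def minus_mat_1_mult det_minus_mat_1)
    then have "inv\<^bsub>SL2\<^esub> a = a" by (simp add: inv_equality)
    with a show "inv\<^bsub>SL2\<^esub> a \<in> {mat 1, - mat 1}" by simp
  qed (auto simp: SL2_def minus_mat_1_mult det_minus_mat_1)
  then show ?thesis
    by (intro normalI)
       (auto simp: l_coset_def r_coset_def, auto simp: SL2_def minus_mat_1_mult)
qed

lemma group_PSL2: "group PSL2"
  unfolding PSL2_def using normal_SL2 by (rule normal.factorgroup_is_group)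


section \<open>The dual group and the 2-form\<close>

definition PSL2_star :: "(mat2 set \<times> mat2 set) set" where
  "PSL2_star = {(psl (minus_mat K e), psl (plus_mat K f)) | K e f. K > 0}"

definition Q_map :: "mat2 set \<Rightarrow> mat2 set \<Rightarrow> mat2 set \<times> mat2 set" where
  "Q_map M p = (psl (m_minus M p), psl (m_plus M p))"

lemma Q_map_in_PSL2_star:
  assumes "M \<in> carrier PSL2" "p \<in> U_dom M"
  shows "Q_map M p \<in> PSL2_star"
proof -
  interpret group PSL2 by (rule group_PSL2)
  have "monodromy M p \<in> carrier PSL2" "\<forall>A\<in>monodromy M p. A $ 1 $ 1 \<noteq> 0"
    using assms by (auto simp: monodromy_def U_dom_def)
  from theI'[OF decomp_unique[OF this]] show ?thesis
    by (cases "coords (monodromy M p)")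
       (auto simp: Q_map_def PSL2_star_def m_minus_def m_plus_def coords_def)
qed

text \<open>
  \<open>pairing x \<sigma>\<close> is \<open>x[\<sigma>]\<close>, for \<open>x\<close> in \<open>sl2_star\<close>. A form with values in \<open>sl2_star\<close> is a form
  with values in pairs of matrices.
\<close>

definition sl2_star :: "(mat2 \<times> mat2) set" where
  "sl2_star = {(mk (- a) 0 c a, mk a b 0 (- a)) | a b c. True}"

definition pairing :: "mat2 \<times> mat2 \<Rightarrow> mat2 \<Rightarrow> real" where
  "pairing x \<sigma> = - tr ((snd x - fst x) ** \<sigma>)"

definition left_log_pair :: "(mat2 set \<Rightarrow> mat2 set \<times> mat2 set) \<Rightarrow> (mat2 \<times> mat2) form1" where
  "left_log_pair Q p \<xi> = (left_log (\<lambda>q. fst (Q q)) p \<xi>, left_log (\<lambda>q. snd (Q q)) p \<xi>)"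

definition wedge_pair :: "(mat2 \<times> mat2) form1 \<Rightarrow> (mat2 \<times> mat2) form1 \<Rightarrow> (mat2 \<times> mat2) form2" where
  "wedge_pair \<alpha> \<beta> p \<xi> \<eta> =
     (wedge (\<lambda>q \<zeta>. fst (\<alpha> q \<zeta>)) (\<lambda>q \<zeta>. fst (\<beta> q \<zeta>)) p \<xi> \<eta>,
      wedge (\<lambda>q \<zeta>. snd (\<alpha> q \<zeta>)) (\<lambda>q \<zeta>. snd (\<beta> q \<zeta>)) p \<xi> \<eta>)"

text \<open>
  \<open>W\<^sub>0\<close> is the identity function of \<open>PSL(2,\<real>)\<close>. The sign of the representative of \<open>M\<close> cancels
  between \<open>M\<close> and its inverse.
\<close>

definition Omega :: "real \<Rightarrow> mat2 set \<Rightarrow> real form2" where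
  "Omega k M p \<xi> \<eta> = k / (4 * pi) * tr (
     wedge (\<lambda>q \<zeta>. right_log (\<lambda>W0. W0) q \<zeta> ** rep M)
           (\<lambda>q \<zeta>. right_log (\<lambda>W0. W0) q \<zeta> ** matrix_inv (rep M)) p \<xi> \<eta>
   + wedge (\<lambda>q \<zeta>. ext_d (m_plus M) q \<zeta> ** matrix_inv (m_plus M q))
           (\<lambda>q \<zeta>. ext_d (m_minus M) q \<zeta> ** matrix_inv (m_minus M q)) p \<xi> \<eta>)"

end

theory Submission
  imports Defs
begin

text \<open>
  Put \<open>m = W\<^sup>-\<^sup>1 M W\<close>. In the left-invariant encoding \<open>\<delta>m\<close> is \<open>\<xi> \<mapsto> [m, \<xi>]\<close>, and by cyclicity of the trace
  \<open>\<Omega>\<close> depends on \<open>W\<close> only through \<open>m\<close>: it is a rational function of the entries of \<open>m\<close> and of the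
  two tangent vectors. The first identity is then an identity between such functions. The flow of
  \<open>X\<close> is right multiplication by the one-parameter subgroup \<open>E\<close> generated by \<open>(2\<pi>/k) \<sigma>\<close>, under which
  \<open>m\<close> and the transported tangent vectors are all conjugated by \<open>E\<close>. Hence the term with \<open>\<delta>W W\<^sup>-\<^sup>1\<close> is
  constant along the flow, and the Lie derivative is found by differentiating the other term.
\<close>

section \<open>Two by two matrices and one-parameter subgroups\<close>

text \<open>The adjugate is the inverse on SL(2,R), but linear in the entries, so products with it
  are polynomial.\<close>

definition adj2 :: "mat2 \<Rightarrow> mat2" where
  "adj2 A = mk (A $ 2 $ 2) (- A $ 1 $ 2) (- A $ 2 $ 1) (A $ 1 $ 1)"

lemma mat2_eq_iff:
  "A = B \<longleftrightarrow> A $ 1 $ 1 = B $ 1 $ 1 \<and> A $ 1 $ 2 = B $ 1 $ 2 \<and> A $ 2 $ 1 = B $ 2 $ 1 \<and> A $ 2 $ 2 = B $ 2 $ 2"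
  for A B :: mat2
  by (auto intro: mat2_eqI)

lemma mat_1_nth2 [simp]:
  "(mat 1 :: mat2) $ 1 $ 1 = 1" "(mat 1 :: mat2) $ 1 $ 2 = 0"
  "(mat 1 :: mat2) $ 2 $ 1 = 0" "(mat 1 :: mat2) $ 2 $ 2 = 1"
  by (simp_all add: mat_def)

lemmas mat2_entries = mat2_eq_iff matrix_mult_nth2 adj2_def

lemma trace_2: "trace A = A $ 1 $ 1 + A $ 2 $ 2" for A :: mat2
  by (simp add: trace_def sum_2)

lemma sl2_iff: "A \<in> sl2 \<longleftrightarrow> A $ 2 $ 2 = - A $ 1 $ 1"
  by (auto simp: sl2_def trace_2)

lemma SL2_simps [simp]:
  "W \<in> carrier SL2 \<longleftrightarrow> det W = 1" "V \<otimes>\<^bsub>SL2\<^esub> W = V ** W" "\<one>\<^bsub>SL2\<^esub> = mat 1"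
  by (simp_all add: SL2_def)

lemma adj2_mult: "adj2 (A ** B) = adj2 B ** adj2 A"
  by (simp add: mat2_entries algebra_simps)

lemma det_adj2 [simp]: "det (adj2 A) = det A"
  by (simp add: adj2_def det_2)

lemma det_uminus_mat2 [simp]: "det (- A) = det A" for A :: mat2
  by (simp add: det_2)

lemma adj2_uminus: "adj2 (- A) = - adj2 A"
  by (simp add: mat2_entries)

lemma uminus_matrix_mult: "(- A) ** B = - (A ** B)" "A ** (- B) = - (A ** B)" for A B :: mat2
  by (simp_all add: mat2_entries)

lemma scaleR_matrix_mult: "(c *\<^sub>R A) ** B = c *\<^sub>R (A ** B)" "A ** (c *\<^sub>R B) = c *\<^sub>R (A ** B)" for A B :: mat2
  by (simp_all add: mat2_entries algebra_simps)

lemma adj2_inverse: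
  assumes "det A = 1"
  shows "adj2 A ** A = mat 1" "A ** adj2 A = mat 1"
  using assms by (simp_all add: mat2_entries det_2 algebra_simps)

lemma matrix_inv_det_1:
  fixes A :: mat2
  assumes "det A = 1"
  shows "matrix_inv A = adj2 A"
proof -
  have "A ** matrix_inv A = mat 1 \<and> matrix_inv A ** A = mat 1"
    unfolding matrix_inv_def by (rule someI[of _ "adj2 A"]) (use adj2_inverse[OF assms] in auto)
  then show ?thesis
    using adj2_inverse(1)[OF assms] by (metis matrix_mul_assoc matrix_mul_lid matrix_mul_rid)
qed

lemma SL2_cancel_left:
  fixes A :: mat2
  assumes "det A = 1" "A ** B = A ** C"
  shows "B = C"
  using assms adj2_inverse(1) by (metis matrix_mul_assoc matrix_mul_lid)

section \<open>Differentiation of matrix-valued maps\<close>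

lemma bounded_bilinear_matrix_mult: "bounded_bilinear ((**) :: mat2 \<Rightarrow> mat2 \<Rightarrow> mat2)"
  unfolding bilinear_conv_bounded_bilinear[symmetric] bilinear_def
  by (auto intro!: linearI simp: mat2_entries algebra_simps)

lemmas has_derivative_matrix_mult [derivative_intros] =
  bounded_bilinear.FDERIV[OF bounded_bilinear_matrix_mult]

lemma bounded_linear_adj2: "bounded_linear adj2"
  unfolding linear_conv_bounded_linear[symmetric]
  by (auto intro!: linearI simp: mat2_entries algebra_simps)

lemma bounded_linear_mat2_nth: "bounded_linear (\<lambda>A :: mat2. A $ i $ j)"
  using bounded_linear_compose[OF bounded_linear_vec_nth bounded_linear_vec_nth] .

lemma has_derivative_mat2I:
  fixes F :: "'a::real_normed_vector \<Rightarrow> mat2"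
  assumes "\<And>i j. ((\<lambda>x. F x $ i $ j) has_derivative (\<lambda>h. F' h $ i $ j)) (at x within S)"
  shows "(F has_derivative F') (at x within S)"
proof -
  have eq: "A = A $ 1 $ 1 *\<^sub>R mk 1 0 0 0 + A $ 1 $ 2 *\<^sub>R mk 0 1 0 0
      + A $ 2 $ 1 *\<^sub>R mk 0 0 1 0 + A $ 2 $ 2 *\<^sub>R mk 0 0 0 1" for A :: mat2
    by (simp add: mat2_entries)
  have "((\<lambda>x. F x $ 1 $ 1 *\<^sub>R mk 1 0 0 0 + F x $ 1 $ 2 *\<^sub>R mk 0 1 0 0
      + F x $ 2 $ 1 *\<^sub>R mk 0 0 1 0 + F x $ 2 $ 2 *\<^sub>R mk 0 0 0 1) has_derivative
      (\<lambda>x. F' x $ 1 $ 1 *\<^sub>R mk 1 0 0 0 + F' x $ 1 $ 2 *\<^sub>R mk 0 1 0 0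
      + F' x $ 2 $ 1 *\<^sub>R mk 0 0 1 0 + F' x $ 2 $ 2 *\<^sub>R mk 0 0 0 1)) (at x within S)"
    by (intro has_derivative_add has_derivative_scaleR_left assms)
  then show ?thesis by (simp only: eq[symmetric])
qed

text \<open>These are the coefficients of \<open>exp (t \<xi>) = c t + s t \<xi>\<close> for
  traceless \<open>\<xi>\<close> of determinant \<open>d\<close>: circular, polynomial or hyperbolic
  functions according to the sign of \<open>d\<close>. The last property says that the exponential
  has determinant 1.\<close>

lemma one_parameter_coefficients:
  fixes d :: real
  obtains c s where "c 0 = 1" "s 0 = 0" "\<And>t. (c has_real_derivative - d * s t) (at t)"
    "\<And>t. (s has_real_derivative c t) (at t)" "\<And>t. (c t)\<^sup>2 + d * (s t)\<^sup>2 = 1"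
proof (cases d "0 :: real" rule: linorder_cases)
  case equal
  show ?thesis
    by (rule that[of "\<lambda>_. 1" "\<lambda>t. t"]) (use equal in \<open>auto intro!: derivative_eq_intros\<close>)
next
  case greater
  define r where "r = sqrt d"
  have r: "r > 0" "d = r\<^sup>2" using greater by (auto simp: r_def)
  show ?thesis
  proof (rule that[of "\<lambda>t. cos (r * t)" "\<lambda>t. sin (r * t) / r"])
    fix t
    show "(cos (r * t))\<^sup>2 + d * (sin (r * t) / r)\<^sup>2 = 1"
      using r by (simp add: power_divide)
  qed (use r in \<open>auto intro!: derivative_eq_intros simp: power2_eq_square\<close>)
next
  case less
  define r where "r = sqrt (- d)"
  have r: "r > 0" "d = - r\<^sup>2" using less by (auto simp: r_def)
  show ?thesis
  proof (rule that[of "\<lambda>t. cosh (r * t)" "\<lambda>t. sinh (r * t) / r"])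
    fix t
    show "(cosh (r * t))\<^sup>2 + d * (sinh (r * t) / r)\<^sup>2 = 1"
      using r by (simp add: power_divide cosh_square_eq)
  qed (use r in \<open>auto intro!: derivative_eq_intros simp: power2_eq_square\<close>)
qed

text \<open>By Cayley-Hamilton the square of a traceless \<open>\<xi>\<close> is
  \<open>- det \<xi>\<close>, so its exponential stays in the span of \<open>mat 1\<close> and
  \<open>\<xi>\<close>. The curve realizes a prescribed tangent vector inside SL(2,R), and later
  gives the flow.\<close>

lemma one_parameter_subgroup:
  assumes "\<xi> \<in> sl2"
  obtains E where "E 0 = mat 1" "\<And>t. det (E t) = 1"
    "\<And>t. (E has_vector_derivative E t ** \<xi>) (at t)" "\<And>t. E t ** \<xi> = \<xi> ** E t"
proof -
  obtain c s where cs: "c 0 = 1" "s 0 = 0" "\<And>t. (c has_real_derivative - det \<xi> * s t) (at t)"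
    "\<And>t. (s has_real_derivative c t) (at t)" "\<And>t. (c t)\<^sup>2 + det \<xi> * (s t)\<^sup>2 = 1"
    using one_parameter_coefficients by blast
  have sq: "\<xi> ** \<xi> = - det \<xi> *\<^sub>R mat 1"
    using assms by (simp add: mat2_entries sl2_iff det_2 algebra_simps)
  define E where "E t = c t *\<^sub>R mat 1 + s t *\<^sub>R \<xi>" for t
  show ?thesis
  proof (rule that[of E])
    fix t
    show "det (E t) = 1"
      using cs(5)[of t] assms by (simp add: E_def det_2 sl2_iff power2_eq_square algebra_simps)
    show "E t ** \<xi> = \<xi> ** E t"
      by (simp add: E_def mat2_entries algebra_simps)
    have "(E has_vector_derivative (- det \<xi> * s t) *\<^sub>R mat 1 + c t *\<^sub>R \<xi>) (at t)"
      unfolding E_def by (auto intro!: derivative_eq_intros cs)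
    also have "(- det \<xi> * s t) *\<^sub>R mat 1 + c t *\<^sub>R \<xi> = E t ** \<xi>"
      using assms by (simp add: E_def mat2_entries det_2 sl2_iff algebra_simps)
    finally show "(E has_vector_derivative E t ** \<xi>) (at t)" .
  qed (use cs in \<open>simp add: E_def\<close>)
qed

section \<open>Calculus on PSL(2,R)\<close>

lemma psl_uminus [simp]: "psl (- W) = psl W"
  by (auto simp: psl_eq)

lemma carrier_PSL2: "carrier PSL2 = psl ` {W. det W = 1}"
  unfolding PSL2_def carrier_FactGroup psl_def by (simp add: SL2_def image_def)

lemma psl_in_carrier [simp]: "det W = 1 \<Longrightarrow> psl W \<in> carrier PSL2"
  by (auto simp: carrier_PSL2)

lemma PSL2_memD:
  assumes "p \<in> carrier PSL2" "W \<in> p"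
  shows "det W = 1" "p = psl W"
  using assms by (auto simp: carrier_PSL2 psl_eq)

lemma rep_in: "p \<in> carrier PSL2 \<Longrightarrow> rep p \<in> p"
  unfolding rep_def by (rule someI_ex) (auto simp: carrier_PSL2 psl_eq)

lemma psl_mult:
  assumes "det A = 1" "det B = 1"
  shows "psl A \<otimes>\<^bsub>PSL2\<^esub> psl B = psl (A ** B)"
  using normal.rcos_sum[OF normal_SL2, of A B] assms by (simp add: PSL2_def psl_def)

lemma psl_inv:
  assumes "det A = 1"
  shows "inv\<^bsub>PSL2\<^esub> (psl A) = psl (adj2 A)"
proof -
  interpret group PSL2 by (rule group_PSL2)
  have "psl (adj2 A) \<otimes>\<^bsub>PSL2\<^esub> psl A = psl (mat 1)"
    using assms by (simp add: psl_mult adj2_inverse)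
  also have "\<dots> = \<one>\<^bsub>PSL2\<^esub>"
    by (auto simp: PSL2_def psl_eq)
  finally show ?thesis
    using assms by (intro inv_equality) auto
qed

text \<open>For \<open>V\<close> in \<open>SL(2,\<real>)\<close> this is \<open>V\<^sup>-\<^sup>1 A V\<close>; with \<open>adj2\<close> it is polynomial in \<open>V\<close> and defined for all \<open>V\<close>.\<close>

definition conj2 :: "mat2 \<Rightarrow> mat2 \<Rightarrow> mat2" where
  "conj2 V A = adj2 V ** A ** V"

lemma det_conj2: "det V = 1 \<Longrightarrow> det (conj2 V A) = det A"
  by (simp add: conj2_def det_mul)

lemma conj2_uminus [simp]: "conj2 (- V) A = conj2 V A" "conj2 V (- A) = - conj2 V A"
  by (simp_all add: conj2_def adj2_uminus uminus_matrix_mult)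

lemma conj2_conj2: "conj2 V (conj2 W A) = conj2 (W ** V) A"
  by (simp add: conj2_def adj2_mult matrix_mul_assoc)

lemma monodromy_psl:
  assumes "det A = 1" "det W = 1"
  shows "monodromy (psl A) (psl W) = psl (conj2 W A)"
  using assms by (simp add: monodromy_def psl_inv psl_mult det_mul conj2_def)

lemma psl_in_U_dom:
  assumes "det A = 1" "det W = 1"
  shows "psl W \<in> U_dom (psl A) \<longleftrightarrow> conj2 W A $ 1 $ 1 \<noteq> 0"
  using assms by (auto simp: U_dom_def monodromy_psl psl_eq[of "conj2 W A"])

text \<open>A derivative within SL(2,R) is not unique as a linear map on matrices; this chain rule
  pins down its values on velocities of curves inside SL(2,R).\<close>

lemma has_vector_derivative_SL2_compose:
  fixes h :: "mat2 \<Rightarrow> 'b::real_normed_vector"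
  assumes h: "(h has_derivative D) (at (c 0) within carrier SL2)"
    and c: "(c has_vector_derivative v) (at (0::real))" "\<And>t. det (c t) = 1"
  shows "((\<lambda>t. h (c t)) has_vector_derivative D v) (at 0)"
proof -
  have "(h has_derivative D) (at (c 0) within range c)"
    using h by (rule has_derivative_subset) (use c(2) in auto)
  from has_derivative_in_compose[OF c(1)[unfolded has_vector_derivative_def] this]
  show ?thesis
    unfolding has_vector_derivative_def
    by (simp add: linear_scale[OF has_derivative_linear[OF h]])
qed

text \<open>\<open>frechet_derivative\<close> selects some derivative, possibly not
  \<open>D\<close>. The two agree on \<open>rep p ** \<xi>\<close>, since both give the velocity of
  the image of the curve \<open>rep p ** E t\<close>.\<close>

lemma ext_d_eq:
  assumes p: "p \<in> carrier PSL2" and \<xi>: "\<xi> \<in> sl2"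
    and D: "((\<lambda>W. f (psl W)) has_derivative D) (at (rep p) within carrier SL2)"
  shows "ext_d f p \<xi> = D (rep p ** \<xi>)"
proof -
  obtain E where E: "E 0 = mat 1" "\<And>t. det (E t) = 1"
    "\<And>t. (E has_vector_derivative E t ** \<xi>) (at t)" "\<And>t. E t ** \<xi> = \<xi> ** E t"
    by (rule one_parameter_subgroup[OF \<xi>]) (rule that)
  define c where "c = (\<lambda>t. rep p ** E t)"
  have c0: "c 0 = rep p" by (simp add: c_def E)
  have c: "(c has_vector_derivative rep p ** \<xi>) (at 0)"
    using bounded_linear.has_vector_derivative[OF
        bounded_bilinear.bounded_linear_right[OF bounded_bilinear_matrix_mult] E(3)[of 0]]
    by (simp add: c_def E(1))
  have det: "det (c t) = 1" for t
    using PSL2_memD(1)[OF p rep_in[OF p]] E(2) by (simp add: c_def det_mul)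
  let ?F = "frechet_derivative (\<lambda>W. f (psl W)) (at (rep p) within carrier SL2)"
  have F: "((\<lambda>W. f (psl W)) has_derivative ?F) (at (rep p) within carrier SL2)"
    using D by (auto simp: frechet_derivative_works[symmetric] differentiable_def)
  note 1 = has_vector_derivative_SL2_compose[OF F[folded c0] c det]
  note 2 = has_vector_derivative_SL2_compose[OF D[folded c0] c det]
  from vector_derivative_unique_at[OF 1 2] show ?thesis
    by (simp add: ext_d_def c0)
qed

text \<open>Turns a tangent map into a lift \<open>u\<close> of the image of a curve, with known
  velocity. \<open>W\<close> may be the negative of the representative used by the tangent map; both
  give the same curve in PSL(2,R).\<close>

lemma has_tangent_map_curve:
  assumes g: "has_tangent_map g A p" and p: "p \<in> carrier PSL2" and W: "W \<in> p" and \<xi>: "\<xi> \<in> sl2"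
    and E: "E (0::real) = mat 1" "\<And>t. det (E t) = 1" "(E has_vector_derivative \<xi>) (at 0)"
  obtains u where "(u has_vector_derivative u 0 ** A \<xi>) (at 0)" "u 0 \<in> g p"
    "\<forall>\<^sub>F t in at 0. u t \<in> g (psl (W ** E t))"
proof -
  obtain V h D where V: "V \<in> p" and h: "(h has_derivative D) (at V within carrier SL2)"
    and hV: "h V \<in> g p" and ev: "\<forall>\<^sub>F V' in at V within carrier SL2. h V' \<in> g (psl V')"
    and D: "\<And>\<xi>. \<xi> \<in> sl2 \<Longrightarrow> D (V ** \<xi>) = h V ** A \<xi>"
    using g unfolding has_tangent_map_def by blast
  have pV: "p = psl V" "det V = 1" using PSL2_memD[OF p V] by auto
  define c where "c = (\<lambda>t. V ** E t)"
  have c0: "c 0 = V" by (simp add: c_def E)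
  have c: "(c has_vector_derivative V ** \<xi>) (at 0)"
    using bounded_linear.has_vector_derivative[OF
        bounded_bilinear.bounded_linear_right[OF bounded_bilinear_matrix_mult] E(3)]
    by (simp add: c_def)
  have det: "det (c t) = 1" for t using pV E(2) by (simp add: c_def det_mul)
  have same: "psl (c t) = psl (W ** E t)" for t
    using W by (auto simp: c_def pV(1) psl_eq uminus_matrix_mult)
  \<comment> \<open>The filter \<open>at V\<close> leaves out \<open>V\<close> itself, to which the
    curve may return, for instance when \<open>\<xi> = 0\<close>; \<open>hV\<close> covers that
    point.\<close>
  obtain d where d: "d > 0" "\<And>V'. det V' = 1 \<Longrightarrow> dist V' V < d \<Longrightarrow> h V' \<in> g (psl V')"
    using ev hV unfolding eventually_at by (metis SL2_simps(1) pV(1))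
  have "(c \<longlongrightarrow> V) (at 0)"
    using has_vector_derivative_continuous[OF c] by (simp add: continuous_within c0)
  then have "\<forall>\<^sub>F t in at 0. dist (c t) V < d" using d(1) by (rule tendstoD)
  then have "\<forall>\<^sub>F t in at 0. h (c t) \<in> g (psl (W ** E t))"
    by eventually_elim (use d(2) det same in metis)
  moreover have "((\<lambda>t. h (c t)) has_vector_derivative h V ** A \<xi>) (at 0)"
    using has_vector_derivative_SL2_compose[OF h[folded c0] c det] D[OF \<xi>] by (simp add: c0)
  ultimately show ?thesis
    using that[of "\<lambda>t. h (c t)"] hV c0 by simp
qed

text \<open>Justifies the definite description in \<open>left_log\<close>: the lifts of one image
  curve obtained from the two tangent maps differ at each time by at most a sign.\<close>

lemma has_tangent_map_unique:
  assumes g: "has_tangent_map g A p" "has_tangent_map g B p"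
    and p: "p \<in> carrier PSL2" and \<xi>: "\<xi> \<in> sl2"
    and gp: "g p \<in> carrier PSL2" and psl: "\<And>q. q \<in> carrier PSL2 \<Longrightarrow> \<exists>G. g q = psl G"
  shows "A \<xi> = B \<xi>"
proof -
  obtain E where E: "E 0 = mat 1" "\<And>t. det (E t) = 1"
    "\<And>t. (E has_vector_derivative E t ** \<xi>) (at t)" "\<And>t. E t ** \<xi> = \<xi> ** E t"
    by (rule one_parameter_subgroup[OF \<xi>]) (rule that)
  have E': "(E has_vector_derivative \<xi>) (at 0)" using E(3)[of 0] E(1) by simp
  obtain W where W: "W \<in> p" using rep_in[OF p] by blast
  have detW: "det W = 1" using PSL2_memD[OF p W] by simp
  obtain u where u: "(u has_vector_derivative u 0 ** A \<xi>) (at 0)" "u 0 \<in> g p"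
    "\<forall>\<^sub>F t in at 0. u t \<in> g (psl (W ** E t))"
    by (rule has_tangent_map_curve[OF g(1) p W \<xi> E(1,2) E'])
  obtain v where v: "(v has_vector_derivative v 0 ** B \<xi>) (at 0)" "v 0 \<in> g p"
    "\<forall>\<^sub>F t in at 0. v t \<in> g (psl (W ** E t))"
    by (rule has_tangent_map_curve[OF g(2) p W \<xi> E(1,2) E'])
  have pm: "\<forall>\<^sub>F t in at 0. u t = v t \<or> u t = - v t"
    using u(3) v(3)
  proof eventually_elim
    case (elim t)
    have "psl (W ** E t) \<in> carrier PSL2" using E(2) detW by (simp add: det_mul)
    then obtain G where "g (psl (W ** E t)) = psl G" using psl by blast
    then show ?case using elim by (auto simp: psl_eq)
  qed
  have det_u0: "det (u 0) = 1" and det_v0: "det (v 0) = 1" and gu: "g p = psl (u 0)"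
    using PSL2_memD[OF gp u(2)] PSL2_memD[OF gp v(2)] by auto
  obtain s :: real where s: "s = 1 \<or> s = -1" "v 0 = s *\<^sub>R u 0"
    using v(2) unfolding gu psl_eq by (metis insertE singletonD scaleR_one scaleR_minus1_left)
  define w where "w = (\<lambda>t. s *\<^sub>R v t)"
  have w0: "w 0 = u 0" using s by (auto simp: w_def)
  have w: "(w has_vector_derivative w 0 ** B \<xi>) (at 0)"
  proof -
    have "(w has_vector_derivative s *\<^sub>R (v 0 ** B \<xi>)) (at 0)"
      using bounded_linear.has_vector_derivative[OF bounded_linear_scaleR_right v(1)] by (simp add: w_def)
    then show ?thesis by (simp add: w_def scaleR_matrix_mult)
  qed
  \<comment> \<open>Both curves are continuous lifts of the same curve in \<open>PSL2\<close>, so they agree near 0.\<close>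
  have lim: "((\<lambda>t. u t + w t) \<longlongrightarrow> u 0 + w 0) (at 0)"
    using has_vector_derivative_continuous[OF u(1)] has_vector_derivative_continuous[OF w]
    by (intro tendsto_add) (auto simp: continuous_within)
  \<comment> \<open>The alternative \<open>w t = - u t\<close> would make the sum vanish; its limit
    is twice \<open>u 0\<close>, which is nonzero.\<close>
  have "u 0 + w 0 \<noteq> 0"
  proof
    assume "u 0 + w 0 = 0"
    then have "u 0 = 0" by (simp add: w0 mat2_entries)
    then show False using det_u0 by (simp add: det_2)
  qed
  from tendsto_imp_eventually_ne[OF lim this] pm have "\<forall>\<^sub>F t in at 0. w t = u t"
    by eventually_elim (use s in \<open>auto simp: w_def\<close>)
  from has_derivative_transform_eventually[OF w[unfolded has_vector_derivative_def] this]
  have "(u has_vector_derivative u 0 ** B \<xi>) (at 0)"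
    by (simp add: w0 has_vector_derivative_def)
  then have "u 0 ** A \<xi> = u 0 ** B \<xi>"
    using u(1) vector_derivative_unique_at by blast
  then show ?thesis by (rule SL2_cancel_left[OF det_u0])
qed

lemma left_log_eq:
  assumes "has_tangent_map g A p" "p \<in> carrier PSL2" "\<xi> \<in> sl2"
    "g p \<in> carrier PSL2" "\<And>q. q \<in> carrier PSL2 \<Longrightarrow> \<exists>G. g q = psl G"
  shows "left_log g p \<xi> = A \<xi>"
  unfolding left_log_def using assms has_tangent_map_unique by (intro the_equality) blast+

lemma left_log_id:
  assumes p: "p \<in> carrier PSL2" and \<xi>: "\<xi> \<in> sl2"
  shows "left_log (\<lambda>q. q) p \<xi> = \<xi>"
proof -
  have "has_tangent_map (\<lambda>q. q) (\<lambda>\<xi>. \<xi>) p"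
    unfolding has_tangent_map_def
    by (rule bexI[OF _ rep_in[OF p]], rule exI[of _ "\<lambda>W. W"], rule exI[of _ "\<lambda>H. H"])
      (use rep_in[OF p] in \<open>auto simp: psl_eq\<close>)
  from left_log_eq[OF this p \<xi>] show ?thesis using p by (auto simp: carrier_PSL2)
qed

section \<open>Derivatives of the factors\<close>

definition comm2 :: "mat2 \<Rightarrow> mat2 \<Rightarrow> mat2" where
  "comm2 A B = A ** B - B ** A"

text \<open>
  \<open>log_plus m P\<close> and \<open>log_minus m P\<close> are the values of \<open>m\<^sub>+\<^sup>-\<^sup>1 \<delta>m\<^sub>+\<close> and \<open>m\<^sub>-\<^sup>-\<^sup>1 \<delta>m\<^sub>-\<close> when \<open>\<delta>m\<close> has the value
  \<open>P\<close>. Both are unchanged under \<open>(m, P) \<mapsto> (-m, -P)\<close>, so the sign of \<open>m\<close> is irrelevant.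
\<close>

definition log_plus :: "mat2 \<Rightarrow> mat2 \<Rightarrow> mat2" where
  "log_plus m P = mk (P $ 1 $ 1 / (2 * m $ 1 $ 1)) (P $ 1 $ 2 / m $ 1 $ 1) 0 (- P $ 1 $ 1 / (2 * m $ 1 $ 1))"

definition log_minus :: "mat2 \<Rightarrow> mat2 \<Rightarrow> mat2" where
  "log_minus m P = mk (- P $ 1 $ 1 / (2 * m $ 1 $ 1)) 0 (- P $ 2 $ 1 / m $ 1 $ 1) (P $ 1 $ 1 / (2 * m $ 1 $ 1))"

text \<open>Three entries of \<open>decomp\<close> determine \<open>K\<close>, \<open>e\<close> and
  \<open>f\<close> once \<open>K > 0\<close>; the lower right entry then matches because
  \<open>det m = 1\<close>.\<close>

lemma coords_psl:
  assumes "det m = 1" and neg: "m $ 1 $ 1 < 0"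
  shows "coords (psl m) = (sqrt (- m $ 1 $ 1), m $ 2 $ 1 / sqrt (- m $ 1 $ 1), - m $ 1 $ 2 / sqrt (- m $ 1 $ 1))"
proof -
  define K where "K = sqrt (- m $ 1 $ 1)"
  have K: "K > 0" "m $ 1 $ 1 = - K\<^sup>2" using neg by (auto simp: K_def)
  have "- (K\<^sup>2 * m $ 2 $ 2) = 1 + m $ 1 $ 2 * m $ 2 $ 1"
    using assms(1) K(2) by (simp add: det_2)
  then have "decomp K (m $ 2 $ 1 / K) (- m $ 1 $ 2 / K) = m"
    using K by (simp add: decomp_def mat2_eq_iff field_simps power2_eq_square)
  then have mem: "decomp K (m $ 2 $ 1 / K) (- m $ 1 $ 2 / K) \<in> psl m"
    by (simp add: psl_eq)
  have "\<forall>A\<in>psl m. A $ 1 $ 1 \<noteq> 0" using neg by (auto simp: psl_eq)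
  from the1_equality[OF decomp_unique[OF psl_in_carrier[OF assms(1)] this], of "(K, m $ 2 $ 1 / K, - m $ 1 $ 2 / K)"]
  show ?thesis using mem K(1) by (simp add: coords_def K_def)
qed

text \<open>The product rule gives the commutator, since \<open>adj2 \<xi> = - \<xi>\<close> on
  \<open>sl2\<close>. The set \<open>S\<close> is general to cover both SL(2,R) and the full matrix
  space.\<close>

lemma has_derivative_conj2:
  assumes "det W = 1"
  obtains D where "((\<lambda>V. conj2 V A) has_derivative D) (at W within S)"
    "\<And>\<xi>. \<xi> \<in> sl2 \<Longrightarrow> D (W ** \<xi>) = comm2 (conj2 W A) \<xi>"
proof (rule that)
  show "((\<lambda>V. conj2 V A) has_derivative
      (\<lambda>H. adj2 W ** A ** H + (adj2 W ** 0 + adj2 H ** A) ** W)) (at W within S)"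
    unfolding conj2_def
    by (intro derivative_intros bounded_linear.has_derivative[OF bounded_linear_adj2])
  fix \<xi> assume "\<xi> \<in> sl2"
  then have "adj2 \<xi> = - \<xi>" by (simp add: mat2_entries sl2_iff)
  then show "adj2 W ** A ** (W ** \<xi>) + (adj2 W ** 0 + adj2 (W ** \<xi>) ** A) ** W = comm2 (conj2 W A) \<xi>"
    by (simp add: comm2_def conj2_def adj2_mult uminus_matrix_mult matrix_mul_assoc)
qed

lemma m_plus_psl:
  assumes "det A = 1" "det W = 1" "conj2 W A $ 1 $ 1 < 0"
  shows "m_plus (psl A) (psl W) =
    plus_mat (sqrt (- conj2 W A $ 1 $ 1)) (- conj2 W A $ 1 $ 2 / sqrt (- conj2 W A $ 1 $ 1))"
  using coords_psl[of "conj2 W A"] assms by (simp add: m_plus_def monodromy_psl det_conj2)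

lemma m_minus_psl:
  assumes "det A = 1" "det W = 1" "conj2 W A $ 1 $ 1 < 0"
  shows "m_minus (psl A) (psl W) =
    minus_mat (sqrt (- conj2 W A $ 1 $ 1)) (conj2 W A $ 2 $ 1 / sqrt (- conj2 W A $ 1 $ 1))"
  using coords_psl[of "conj2 W A"] assms by (simp add: m_minus_def monodromy_psl det_conj2)

section \<open>The factors near a point where the lift of \<open>m\<close> has negative upper-left
  entry\<close>

context
  fixes A W m :: mat2
  assumes det: "det A = 1" "det W = 1" and m: "m = conj2 W A" and neg: "m $ 1 $ 1 < 0"
begin

lemmas m_pm_base = m_plus_psl[OF det neg[unfolded m], folded m] m_minus_psl[OF det neg[unfolded m], folded m]

lemma det_m: "det m = 1"
  using det by (simp add: m det_conj2)

lemma det_m_pm: "det (m_plus (psl A) (psl W)) = 1" "det (m_minus (psl A) (psl W)) = 1"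
  unfolding m_pm_base using neg by (simp_all add: det_2 plus_mat_def minus_mat_def)

lemma m_minus_mult: "m_minus (psl A) (psl W) ** m = m_plus (psl A) (psl W)"
proof -
  define K where "K = sqrt (- m $ 1 $ 1)"
  have K: "K > 0" "m $ 1 $ 1 = - K\<^sup>2" using neg by (auto simp: K_def)
  have "- (K\<^sup>2 * m $ 2 $ 2) = 1 + m $ 1 $ 2 * m $ 2 $ 1"
    using det_m K(2) by (simp add: det_2)
  then show ?thesis
    unfolding m_pm_base K_def[symmetric] using K
    by (simp add: minus_mat_def plus_mat_def mat2_entries field_simps power2_eq_square)
qed

text \<open>By continuity the same lift \<open>A\<close> keeps serving near \<open>W\<close>, so the
  explicit formulas for the factors can be differentiated there.\<close>

lemma eventually_conj2_neg: "\<forall>\<^sub>F V in at W within S. conj2 V A $ 1 $ 1 < 0"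
proof -
  obtain D where "((\<lambda>V. conj2 V A) has_derivative D) (at W within S)"
    by (rule has_derivative_conj2[OF det(2), where A = A and S = S])
  from has_derivative_continuous[OF bounded_linear.has_derivative[OF bounded_linear_mat2_nth this]]
  have "((\<lambda>V. conj2 V A $ 1 $ 1) \<longlongrightarrow> m $ 1 $ 1) (at W within S)"
    by (simp add: continuous_within m)
  from order_tendstoD(2)[OF this neg] show ?thesis .
qed

text \<open>Chain rule through \<open>K = sqrt (- m $ 1 $ 1)\<close>, \<open>e\<close> and
  \<open>f\<close>; splitting off the factor \<open>m_plus\<close> or \<open>m_minus\<close> on the
  left exhibits the logarithmic derivative.\<close>

lemma has_derivative_m_pm:
  obtains Dp Dm where
    "((\<lambda>V. m_plus (psl A) (psl V)) has_derivative Dp) (at W within carrier SL2)"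
    "\<And>\<xi>. \<xi> \<in> sl2 \<Longrightarrow> Dp (W ** \<xi>) = m_plus (psl A) (psl W) ** log_plus m (comm2 m \<xi>)"
    "((\<lambda>V. m_minus (psl A) (psl V)) has_derivative Dm) (at W within carrier SL2)"
    "\<And>\<xi>. \<xi> \<in> sl2 \<Longrightarrow> Dm (W ** \<xi>) = m_minus (psl A) (psl W) ** log_minus m (comm2 m \<xi>)"
proof -
  obtain D where D: "((\<lambda>V. conj2 V A) has_derivative D) (at W within carrier SL2)"
    "\<And>\<xi>. \<xi> \<in> sl2 \<Longrightarrow> D (W ** \<xi>) = comm2 (conj2 W A) \<xi>"
    by (rule has_derivative_conj2[OF det(2), where A = A and S = "carrier SL2"]) (rule that)
  define K where "K = sqrt (- m $ 1 $ 1)"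
  have K: "K > 0" "m $ 1 $ 1 = - K\<^sup>2" using neg by (auto simp: K_def)
  note entry = bounded_linear.has_derivative[OF bounded_linear_mat2_nth D(1)]
  let ?K = "\<lambda>V. sqrt (- conj2 V A $ 1 $ 1)"
  have K': "sqrt (- conj2 W A $ 1 $ 1) = K" by (simp add: K_def m)
  have "((\<lambda>y. sqrt (- y)) has_real_derivative - 1 / (2 * K)) (at (conj2 W A $ 1 $ 1))"
    by (rule derivative_eq_intros refl | use neg in \<open>simp add: m K_def field_simps\<close>)+
  from DERIV_compose_FDERIV[OF this entry]
  have dK: "(?K has_derivative (\<lambda>H. - D H $ 1 $ 1 / (2 * K))) (at W within carrier SL2)"
    by simp
  have "((\<lambda>y. inverse (sqrt (- y))) has_real_derivative 1 / (2 * K ^ 3)) (at (conj2 W A $ 1 $ 1))"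
    by (rule derivative_eq_intros refl | use K neg in \<open>simp add: m K' field_simps power3_eq_cube\<close>)+
  from DERIV_compose_FDERIV[OF this entry]
  have dinv: "((\<lambda>V. inverse (?K V)) has_derivative (\<lambda>H. D H $ 1 $ 1 / (2 * K ^ 3))) (at W within carrier SL2)"
    by simp
  have df: "((\<lambda>V. - conj2 V A $ 1 $ 2 * inverse (?K V)) has_derivative
      (\<lambda>H. - D H $ 1 $ 2 / K - m $ 1 $ 2 * D H $ 1 $ 1 / (2 * K ^ 3))) (at W within carrier SL2)"
    by (rule has_derivative_eq_rhs[OF has_derivative_mult[OF has_derivative_minus[OF entry] dinv]])
      (use K in \<open>simp add: fun_eq_iff K' m field_simps\<close>)
  have de: "((\<lambda>V. conj2 V A $ 2 $ 1 * inverse (?K V)) has_derivative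
      (\<lambda>H. D H $ 2 $ 1 / K + m $ 2 $ 1 * D H $ 1 $ 1 / (2 * K ^ 3))) (at W within carrier SL2)"
    by (rule has_derivative_eq_rhs[OF has_derivative_mult[OF entry dinv]])
      (use K in \<open>simp add: fun_eq_iff K' m field_simps\<close>)
  have in_SL2: "\<forall>\<^sub>F V in at W within carrier SL2. det V = 1"
    by (simp add: eventually_at_filter)
  \<comment> \<open>The derivatives \<open>dK\<close>, \<open>dinv\<close>, \<open>df\<close> and
    \<open>de\<close> are placed in the entries of \<open>plus_mat\<close> and
    \<open>minus_mat\<close>, with \<open>D H\<close> in the role of
    \<open>\<delta>m\<close>.\<close>
  define Dp where "Dp H = mk (- D H $ 1 $ 1 / (2 * K)) (- D H $ 1 $ 2 / K - m $ 1 $ 2 * D H $ 1 $ 1 / (2 * K ^ 3))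
    0 (D H $ 1 $ 1 / (2 * K ^ 3))" for H
  define Dm where "Dm H = - mk (D H $ 1 $ 1 / (2 * K ^ 3)) 0
    (D H $ 2 $ 1 / K + m $ 2 $ 1 * D H $ 1 $ 1 / (2 * K ^ 3)) (- D H $ 1 $ 1 / (2 * K))" for H
  have "((\<lambda>V. plus_mat (?K V) (- conj2 V A $ 1 $ 2 * inverse (?K V))) has_derivative Dp) (at W within carrier SL2)"
  proof (rule has_derivative_mat2I)
    fix i j :: 2
    show "((\<lambda>V. plus_mat (?K V) (- conj2 V A $ 1 $ 2 * inverse (?K V)) $ i $ j) has_derivative (\<lambda>H. Dp H $ i $ j))
        (at W within carrier SL2)"
      using exhaust_2[of i] exhaust_2[of j] dK dinv df by (auto simp: plus_mat_def Dp_def)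
  qed
  then have Dp: "((\<lambda>V. m_plus (psl A) (psl V)) has_derivative Dp) (at W within carrier SL2)"
  proof (rule has_derivative_transform_eventually)
    show "\<forall>\<^sub>F V in at W within carrier SL2. plus_mat (?K V) (- conj2 V A $ 1 $ 2 * inverse (?K V)) = m_plus (psl A) (psl V)"
      using eventually_conj2_neg in_SL2 by eventually_elim (simp add: m_plus_psl det(1) divide_inverse)
  qed (use det neg in \<open>simp_all add: m_plus_psl m divide_inverse\<close>)
  have "((\<lambda>V. minus_mat (?K V) (conj2 V A $ 2 $ 1 * inverse (?K V))) has_derivative Dm) (at W within carrier SL2)"
  proof (rule has_derivative_mat2I)
    fix i j :: 2
    show "((\<lambda>V. minus_mat (?K V) (conj2 V A $ 2 $ 1 * inverse (?K V)) $ i $ j) has_derivative (\<lambda>H. Dm H $ i $ j))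
        (at W within carrier SL2)"
      using exhaust_2[of i] exhaust_2[of j] has_derivative_minus[OF dK] has_derivative_minus[OF dinv]
        has_derivative_minus[OF de] by (auto simp: minus_mat_def Dm_def)
  qed
  then have Dm: "((\<lambda>V. m_minus (psl A) (psl V)) has_derivative Dm) (at W within carrier SL2)"
  proof (rule has_derivative_transform_eventually)
    show "\<forall>\<^sub>F V in at W within carrier SL2. minus_mat (?K V) (conj2 V A $ 2 $ 1 * inverse (?K V)) = m_minus (psl A) (psl V)"
      using eventually_conj2_neg in_SL2 by eventually_elim (simp add: m_minus_psl det(1) divide_inverse)
  qed (use det neg in \<open>simp_all add: m_minus_psl m divide_inverse\<close>)
  show ?thesis
  proof (rule that[OF Dp _ Dm])
    fix \<xi> assume "\<xi> \<in> sl2"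
    note D = D(2)[OF this, folded m]
    show "Dp (W ** \<xi>) = m_plus (psl A) (psl W) ** log_plus m (comm2 m \<xi>)"
      unfolding Dp_def D m_pm_base K_def[symmetric] using K
      by (simp add: mat2_entries plus_mat_def log_plus_def field_simps power2_eq_square power3_eq_cube)
    show "Dm (W ** \<xi>) = m_minus (psl A) (psl W) ** log_minus m (comm2 m \<xi>)"
      unfolding Dm_def D m_pm_base K_def[symmetric] using K
      by (simp add: mat2_entries minus_mat_def log_minus_def field_simps power2_eq_square power3_eq_cube)
  qed
qed

end

section \<open>The 2-form in terms of the monodromy\<close>

lemma trace_conj:
  assumes "det V = 1"
  shows "trace (V ** B ** adj2 V) = trace B"
proof -
  have "trace (V ** B ** adj2 V) = trace (adj2 V ** (V ** B))"
    by (rule trace_mul_sym)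
  then show ?thesis by (simp add: matrix_mul_assoc adj2_inverse[OF assms])
qed

lemma conj2_mult:
  assumes "det V = 1"
  shows "conj2 V (B ** C) = conj2 V B ** conj2 V C"
proof -
  have "B ** C = B ** (V ** adj2 V) ** C" by (simp add: adj2_inverse[OF assms])
  then show ?thesis by (simp add: conj2_def matrix_mul_assoc)
qed

lemma conj2_diff: "conj2 V (B - C) = conj2 V B - conj2 V C"
  by (simp add: conj2_def mat2_entries algebra_simps)

lemma conj2_comm2: "det V = 1 \<Longrightarrow> conj2 V (comm2 B C) = comm2 (conj2 V B) (conj2 V C)"
  by (simp add: comm2_def conj2_mult conj2_diff)

lemma adj2_adj2 [simp]: "adj2 (adj2 V) = V"
  by (simp add: mat2_entries)

lemma adj2_conj2: "adj2 (conj2 V B) = conj2 V (adj2 B)"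
  by (simp add: conj2_def adj2_mult matrix_mul_assoc)

lemma trace_conj2: "det V = 1 \<Longrightarrow> trace (conj2 V B) = trace B"
  using trace_conj[of "adj2 V" B] by (simp add: conj2_def)

lemma conj2_sl2: "det V = 1 \<Longrightarrow> \<xi> \<in> sl2 \<Longrightarrow> conj2 V \<xi> \<in> sl2"
  by (simp add: sl2_def trace_conj2)

text \<open>The ordinary trace of \<open>\<delta>m\<^sub>+ m\<^sub>+\<^sup>-\<^sup>1
  \<delta>m\<^sub>- m\<^sub>-\<^sup>-\<^sup>1\<close> on two tangent vectors at which
  \<open>\<delta>m\<close> has the values \<open>P\<close> and \<open>Q\<close>, expanded in entries
  so that it can be differentiated directly.\<close>

definition trace_log_form :: "mat2 \<Rightarrow> mat2 \<Rightarrow> mat2 \<Rightarrow> real" where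
  "trace_log_form m P Q = (m $ 2 $ 1 * (P $ 1 $ 2 * Q $ 1 $ 1 - Q $ 1 $ 2 * P $ 1 $ 1)
     + m $ 1 $ 2 * (P $ 1 $ 1 * Q $ 2 $ 1 - Q $ 1 $ 1 * P $ 2 $ 1)) / m $ 1 $ 1
     - (P $ 1 $ 2 * Q $ 2 $ 1 - Q $ 1 $ 2 * P $ 2 $ 1)"

lemma trace_log_form_eq:
  assumes "m $ 1 $ 1 \<noteq> 0"
  shows "trace (m ** log_plus m P ** adj2 m ** log_minus m Q)
    - trace (m ** log_plus m Q ** adj2 m ** log_minus m P) = trace_log_form m P Q"
  using assms
  by (simp add: trace_2 mat2_entries log_plus_def log_minus_def trace_log_form_def field_simps)

text \<open>The 2-form is \<open>k / (8 * pi)\<close> times this: the normalized trace contributes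
  an additional factor 1/2.\<close>

definition Omega_m :: "mat2 \<Rightarrow> mat2 \<Rightarrow> mat2 \<Rightarrow> real" where
  "Omega_m m \<xi> \<eta> = trace (\<xi> ** m ** \<eta> ** adj2 m) - trace (\<eta> ** m ** \<xi> ** adj2 m)
     + trace_log_form m (comm2 m \<xi>) (comm2 m \<eta>)"

text \<open>The signs cancel in each summand, so the form does not see which matrix of a class in
  PSL(2,R) represents \<open>m\<close>.\<close>

lemma trace_log_form_uminus: "trace_log_form (- m) (- P) (- Q) = trace_log_form m P Q"
proof -
  have "(- c * x + - b * y) / - a = (c * x + b * y) / a" for a b c x y :: real
    by (cases "a = 0") (simp_all add: field_simps)
  then show ?thesis by (simp add: trace_log_form_def)
qed

lemma comm2_uminus: "comm2 (- m) \<xi> = - comm2 m \<xi>"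
  by (simp add: comm2_def uminus_matrix_mult)

lemma Omega_m_uminus: "Omega_m (- m) \<xi> \<eta> = Omega_m m \<xi> \<eta>"
  by (simp add: Omega_m_def trace_log_form_uminus comm2_uminus adj2_uminus uminus_matrix_mult)

lemma Omega_m_interior:
  assumes "m $ 1 $ 1 \<noteq> 0" "det m = 1" "\<sigma> \<in> sl2" "\<eta> \<in> sl2"
  shows "Omega_m m \<sigma> \<eta> =
    2 * trace ((log_plus m (comm2 m \<eta>) - log_minus m (comm2 m \<eta>)) ** \<sigma>)"
proof -
  \<comment> \<open>homogenizing by \<open>det m\<close> makes it an identity in the free entries of \<open>m\<close>\<close>
  have "Omega_m m \<sigma> \<eta> =
      2 * det m * trace ((log_plus m (comm2 m \<eta>) - log_minus m (comm2 m \<eta>)) ** \<sigma>)"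
    using assms(1,3,4)
    by (simp add: Omega_m_def trace_log_form_def trace_2 comm2_def mat2_entries log_plus_def log_minus_def
        sl2_iff det_2 field_simps)
  then show ?thesis by (simp add: assms(2))
qed

text \<open>Conjugation by \<open>E t\<close> moves each of \<open>m\<close>, \<open>P\<close> and
  \<open>Q\<close> with velocity its commutator with \<open>\<sigma>\<close>, and the quotient rule
  applies. The commutators in the result are the values of the squared logarithmic forms of the
  second identity.\<close>

lemma trace_log_form_derivative:
  assumes "m $ 1 $ 1 \<noteq> 0" "det m = 1" "\<sigma> \<in> sl2" "\<xi> \<in> sl2" "\<eta> \<in> sl2"
  defines "P \<equiv> comm2 m \<xi>" and "Q \<equiv> comm2 m \<eta>"
  assumes E: "E 0 = mat 1" "(E has_vector_derivative \<sigma>) (at 0)"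
  shows "((\<lambda>t. trace_log_form (conj2 (E t) m) (conj2 (E t) P) (conj2 (E t) Q)) has_real_derivative
    - 2 * trace ((comm2 (log_plus m P) (log_plus m Q) - comm2 (log_minus m P) (log_minus m Q)) ** \<sigma>)) (at 0)"
proof -
  have conj0: "conj2 (E 0) B = B" for B by (simp add: conj2_def E(1) mat2_entries)
  have d: "((\<lambda>t. conj2 (E t) B $ i $ j) has_real_derivative comm2 B \<sigma> $ i $ j) (at 0)" for B i j
  proof -
    obtain D where D: "((\<lambda>V. conj2 V B) has_derivative D) (at (E 0))"
      "\<And>\<xi>. \<xi> \<in> sl2 \<Longrightarrow> D (E 0 ** \<xi>) = comm2 (conj2 (E 0) B) \<xi>"
      by (rule has_derivative_conj2[where A = B and W = "E 0" and S = UNIV]) (simp_all add: E(1))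
    have "((\<lambda>t. conj2 (E t) B) has_vector_derivative D \<sigma>) (at 0)"
      using has_derivative_compose[OF E(2)[unfolded has_vector_derivative_def] D(1)]
      by (simp add: has_vector_derivative_def linear_scale[OF has_derivative_linear[OF D(1)]])
    moreover have "D \<sigma> = comm2 B \<sigma>"
      using D(2)[OF assms(3)] by (simp add: E(1) conj0[unfolded E(1)])
    ultimately show ?thesis
      using bounded_linear.has_vector_derivative[OF bounded_linear_mat2_nth]
      by (metis has_real_derivative_iff_has_vector_derivative)
  qed
  \<comment> \<open>The factor \<open>det m\<close>, equal to 1, makes both sides homogeneous of
    degree two in \<open>m\<close>, so that equality holds for free entries of \<open>m\<close> with
    \<open>m $ 1 $ 1\<close> nonzero.\<close>
  let ?R = "- 2 * det m * trace ((comm2 (log_plus m P) (log_plus m Q)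
    - comm2 (log_minus m P) (log_minus m Q)) ** \<sigma>)"
  \<comment> \<open>\<open>?N'\<close> and \<open>?S'\<close> are the derivatives at 0 of the
    numerator \<open>?N\<close> and of the subtracted term in \<open>trace_log_form\<close>.\<close>
  let ?N' = "(comm2 m \<sigma> $ 2 $ 1 * (P $ 1 $ 2 * Q $ 1 $ 1 - Q $ 1 $ 2 * P $ 1 $ 1)
     + m $ 2 $ 1 * (comm2 P \<sigma> $ 1 $ 2 * Q $ 1 $ 1 + P $ 1 $ 2 * comm2 Q \<sigma> $ 1 $ 1
         - comm2 Q \<sigma> $ 1 $ 2 * P $ 1 $ 1 - Q $ 1 $ 2 * comm2 P \<sigma> $ 1 $ 1)
     + comm2 m \<sigma> $ 1 $ 2 * (P $ 1 $ 1 * Q $ 2 $ 1 - Q $ 1 $ 1 * P $ 2 $ 1)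
     + m $ 1 $ 2 * (comm2 P \<sigma> $ 1 $ 1 * Q $ 2 $ 1 + P $ 1 $ 1 * comm2 Q \<sigma> $ 2 $ 1
         - comm2 Q \<sigma> $ 1 $ 1 * P $ 2 $ 1 - Q $ 1 $ 1 * comm2 P \<sigma> $ 2 $ 1))"
  let ?N = "(m $ 2 $ 1 * (P $ 1 $ 2 * Q $ 1 $ 1 - Q $ 1 $ 2 * P $ 1 $ 1)
     + m $ 1 $ 2 * (P $ 1 $ 1 * Q $ 2 $ 1 - Q $ 1 $ 1 * P $ 2 $ 1))"
  let ?S' = "comm2 P \<sigma> $ 1 $ 2 * Q $ 2 $ 1 + P $ 1 $ 2 * comm2 Q \<sigma> $ 2 $ 1
     - comm2 Q \<sigma> $ 1 $ 2 * P $ 2 $ 1 - Q $ 1 $ 2 * comm2 P \<sigma> $ 2 $ 1"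
  have "((\<lambda>t. trace_log_form (conj2 (E t) m) (conj2 (E t) P) (conj2 (E t) Q)) has_real_derivative
    (?N' * m $ 1 $ 1 - ?N * comm2 m \<sigma> $ 1 $ 1) / (m $ 1 $ 1 * m $ 1 $ 1) - ?S') (at 0)"
    unfolding trace_log_form_def
    by (rule DERIV_cong[OF DERIV_diff[OF DERIV_divide[OF DERIV_add[OF
              DERIV_mult[OF d DERIV_diff[OF DERIV_mult[OF d d] DERIV_mult[OF d d]]]
              DERIV_mult[OF d DERIV_diff[OF DERIV_mult[OF d d] DERIV_mult[OF d d]]]] d]
              DERIV_diff[OF DERIV_mult[OF d d] DERIV_mult[OF d d]]]])
      (unfold conj0, rule assms(1), simp add: algebra_simps)
  moreover have "(?N' * m $ 1 $ 1 - ?N * comm2 m \<sigma> $ 1 $ 1) / (m $ 1 $ 1 * m $ 1 $ 1) - ?S' = ?R"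
    using assms(1,3,4,5)
    by (simp add: P_def Q_def trace_2 comm2_def mat2_entries log_plus_def log_minus_def
        sl2_iff det_2 field_simps)
  ultimately show ?thesis by (simp add: assms(2))
qed

text \<open>Passing from the lift \<open>A\<close> of \<open>M\<close> to \<open>- A\<close> flips
  the sign of the conjugated matrix, so one of the two lifts is suitable.\<close>

lemma U_domE:
  assumes "M \<in> carrier PSL2" "p \<in> U_dom M"
  obtains A where "M = psl A" "det A = 1" "p \<in> carrier PSL2" "conj2 (rep p) A $ 1 $ 1 < 0"
proof -
  obtain A where A: "M = psl A" "det A = 1" using assms(1) by (auto simp: carrier_PSL2)
  have p: "p \<in> carrier PSL2" using assms(2) by (simp add: U_dom_def)
  have W: "det (rep p) = 1" "p = psl (rep p)" using PSL2_memD[OF p rep_in[OF p]] by auto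
  have "conj2 (rep p) A $ 1 $ 1 \<noteq> 0"
    using psl_in_U_dom[OF A(2) W(1)] assms(2) A(1) W(2) by simp
  then consider "conj2 (rep p) A $ 1 $ 1 < 0" | "conj2 (rep p) (- A) $ 1 $ 1 < 0" by fastforce
  then show ?thesis
  proof cases
    case 1
    then show ?thesis using that[of A] A p by simp
  next
    case 2
    then show ?thesis using that[of "- A"] A p by simp
  qed
qed

section \<open>The forms evaluated at the representative \<open>rep p\<close>\<close>

context
  fixes A m :: mat2 and p :: "mat2 set"
  assumes A: "det A = 1" and p: "p \<in> carrier PSL2" and m: "m = conj2 (rep p) A" and neg: "m $ 1 $ 1 < 0"
begin

lemma rep_p: "det (rep p) = 1" "psl (rep p) = p"
  using PSL2_memD[OF p rep_in[OF p]] by auto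

lemmas det_m_pm_at = det_m_pm[OF A rep_p(1) m neg, unfolded rep_p(2)]
  and m_minus_mult_at = m_minus_mult[OF A rep_p(1) m neg, unfolded rep_p(2)]
  and has_derivative_m_pm_at = has_derivative_m_pm[OF A rep_p(1) m neg, unfolded rep_p(2)]

lemma ext_d_m_pm:
  assumes \<xi>: "\<xi> \<in> sl2"
  shows "ext_d (m_plus (psl A)) p \<xi> = m_plus (psl A) p ** log_plus m (comm2 m \<xi>)"
    "ext_d (m_minus (psl A)) p \<xi> = m_minus (psl A) p ** log_minus m (comm2 m \<xi>)"
proof -
  show "ext_d (m_plus (psl A)) p \<xi> = m_plus (psl A) p ** log_plus m (comm2 m \<xi>)"
    by (rule has_derivative_m_pm_at) (simp add: ext_d_eq[OF p \<xi>] \<xi>)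
  show "ext_d (m_minus (psl A)) p \<xi> = m_minus (psl A) p ** log_minus m (comm2 m \<xi>)"
    by (rule has_derivative_m_pm_at) (simp add: ext_d_eq[OF p \<xi>] \<xi>)
qed

text \<open>The matrix functions \<open>m_plus\<close> and \<open>m_minus\<close> lift the
  components of \<open>Q_map\<close> to SL(2,R), so their derivatives give the tangent maps.\<close>

lemma left_log_pair_Q_map:
  assumes \<xi>: "\<xi> \<in> sl2"
  shows "left_log_pair (Q_map (psl A)) p \<xi> = (log_minus m (comm2 m \<xi>), log_plus m (comm2 m \<xi>))"
proof -
  have plus: "has_tangent_map (\<lambda>q. psl (m_plus (psl A) q)) (\<lambda>\<xi>. log_plus m (comm2 m \<xi>)) p"
    by (rule has_derivative_m_pm_at, unfold has_tangent_map_def, rule bexI[OF _ rep_in[OF p]],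
        rule exI[of _ "\<lambda>V. m_plus (psl A) (psl V)"], rule exI, intro conjI, assumption)
      (auto simp: rep_p psl_eq[of "m_plus _ _"])
  have minus: "has_tangent_map (\<lambda>q. psl (m_minus (psl A) q)) (\<lambda>\<xi>. log_minus m (comm2 m \<xi>)) p"
    by (rule has_derivative_m_pm_at, unfold has_tangent_map_def, rule bexI[OF _ rep_in[OF p]],
        rule exI[of _ "\<lambda>V. m_minus (psl A) (psl V)"], rule exI, intro conjI, assumption)
      (auto simp: rep_p psl_eq[of "m_minus _ _"])
  have "left_log (\<lambda>q. psl (m_minus (psl A) q)) p \<xi> = log_minus m (comm2 m \<xi>)"
    by (rule left_log_eq[OF minus p \<xi>]) (auto simp: det_m_pm_at)
  moreover have "left_log (\<lambda>q. psl (m_plus (psl A) q)) p \<xi> = log_plus m (comm2 m \<xi>)"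
    by (rule left_log_eq[OF plus p \<xi>]) (auto simp: det_m_pm_at)
  ultimately show ?thesis by (simp add: left_log_pair_def Q_map_def)
qed

text \<open>Here \<open>right_log\<close> is \<open>W \<xi> W\<^sup>-\<^sup>1\<close> with
  \<open>W = rep p\<close>. Conjugating the whole product by \<open>W\<close> preserves the trace
  and turns the representative of \<open>M\<close> into \<open>m\<close> up to a sign, which occurs
  twice and cancels.\<close>

lemma right_log_wedge_trace:
  assumes "\<xi> \<in> sl2" "\<eta> \<in> sl2"
  shows "trace (wedge (\<lambda>q \<zeta>. right_log (\<lambda>W0. W0) q \<zeta> ** rep (psl A))
           (\<lambda>q \<zeta>. right_log (\<lambda>W0. W0) q \<zeta> ** matrix_inv (rep (psl A))) p \<xi> \<eta>)
    = trace (\<xi> ** m ** \<eta> ** adj2 m) - trace (\<eta> ** m ** \<xi> ** adj2 m)"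
proof -
  let ?W = "rep p" and ?R = "rep (psl A)"
  have R: "?R = A \<or> ?R = - A" "det ?R = 1"
    using rep_in[OF psl_in_carrier[OF A]] PSL2_memD(1)[OF psl_in_carrier[OF A]] by (auto simp: psl_eq)
  have eq: "trace ((?W ** \<xi> ** adj2 ?W ** ?R) ** (?W ** \<eta> ** adj2 ?W ** adj2 ?R))
    = trace (\<xi> ** m ** \<eta> ** adj2 m)" for \<xi> \<eta>
  proof -
    have "(?W ** \<xi> ** adj2 ?W ** ?R) ** (?W ** \<eta> ** adj2 ?W ** adj2 ?R)
        = ?W ** (\<xi> ** conj2 ?W ?R ** \<eta> ** conj2 ?W (adj2 ?R)) ** adj2 ?W"
    proof -
      have "?W ** (\<xi> ** conj2 ?W ?R ** \<eta> ** conj2 ?W (adj2 ?R)) ** adj2 ?W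
        = ?W ** \<xi> ** adj2 ?W ** ?R ** ?W ** \<eta> ** adj2 ?W ** adj2 ?R ** (?W ** adj2 ?W)"
        by (simp add: conj2_def matrix_mul_assoc)
      then show ?thesis by (simp add: adj2_inverse[OF rep_p(1)] matrix_mul_assoc)
    qed
    moreover have "\<xi> ** conj2 ?W ?R ** \<eta> ** conj2 ?W (adj2 ?R) = \<xi> ** m ** \<eta> ** adj2 m"
      using R(1) by (auto simp: m adj2_conj2 adj2_uminus uminus_matrix_mult)
    ultimately show ?thesis by (simp add: trace_conj[OF rep_p(1)])
  qed
  show ?thesis
    using assms
    by (simp add: wedge_def right_log_def left_log_id[OF p] matrix_inv_det_1 rep_p(1) R(2) trace_sub eq)
qed

text \<open>After substituting \<open>m\<^sub>+ = m\<^sub>- m\<close>, the inner factors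
  \<open>m\<^sub>-\<close> cancel and the outer ones drop out of the trace.\<close>

lemma m_pm_wedge_trace:
  assumes "\<xi> \<in> sl2" "\<eta> \<in> sl2"
  shows "trace (wedge (\<lambda>q \<zeta>. ext_d (m_plus (psl A)) q \<zeta> ** matrix_inv (m_plus (psl A) q))
           (\<lambda>q \<zeta>. ext_d (m_minus (psl A)) q \<zeta> ** matrix_inv (m_minus (psl A) q)) p \<xi> \<eta>)
    = trace_log_form m (comm2 m \<xi>) (comm2 m \<eta>)"
proof -
  let ?v = "m_minus (psl A) p" and ?u = "m_plus (psl A) p"
  have eq: "trace (?u ** B ** adj2 ?u ** (?v ** C ** adj2 ?v)) = trace (m ** B ** adj2 m ** C)" for B C
  proof -
    have "?u ** B ** adj2 ?u ** (?v ** C ** adj2 ?v)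
        = ?v ** m ** B ** adj2 m ** (adj2 ?v ** ?v) ** C ** adj2 ?v"
      by (simp add: m_minus_mult_at[symmetric] adj2_mult matrix_mul_assoc)
    also have "\<dots> = ?v ** (m ** B ** adj2 m ** C) ** adj2 ?v"
      by (simp add: adj2_inverse[OF det_m_pm_at(2)] matrix_mul_assoc)
    finally show ?thesis by (simp add: trace_conj[OF det_m_pm_at(2)])
  qed
  have "trace (wedge (\<lambda>q \<zeta>. ext_d (m_plus (psl A)) q \<zeta> ** matrix_inv (m_plus (psl A) q))
           (\<lambda>q \<zeta>. ext_d (m_minus (psl A)) q \<zeta> ** matrix_inv (m_minus (psl A) q)) p \<xi> \<eta>)
    = trace (m ** log_plus m (comm2 m \<xi>) ** adj2 m ** log_minus m (comm2 m \<eta>))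
      - trace (m ** log_plus m (comm2 m \<eta>) ** adj2 m ** log_minus m (comm2 m \<xi>))"
    using assms by (simp add: wedge_def ext_d_m_pm matrix_inv_det_1 det_m_pm_at trace_sub eq)
  then show ?thesis using trace_log_form_eq[of m] neg by simp
qed

lemma Omega_eq_rep:
  assumes "\<xi> \<in> sl2" "\<eta> \<in> sl2"
  shows "Omega k (psl A) p \<xi> \<eta> = k / (8 * pi) * Omega_m m \<xi> \<eta>"
  by (simp add: Omega_def tr_def trace_add right_log_wedge_trace[OF assms] m_pm_wedge_trace[OF assms]
      Omega_m_def field_simps)

end

text \<open>Along the flow the matrix chosen by \<open>rep\<close> is not under control. Sign
  invariance of \<open>Omega_m\<close> makes the formula valid for every choice of lifts.\<close>

lemma Omega_eq:
  assumes "det A = 1" "det W = 1" "conj2 W A $ 1 $ 1 \<noteq> 0" "\<xi> \<in> sl2" "\<eta> \<in> sl2"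
  shows "Omega k (psl A) (psl W) \<xi> \<eta> = k / (8 * pi) * Omega_m (conj2 W A) \<xi> \<eta>"
proof -
  have "psl W \<in> U_dom (psl A)" using assms by (simp add: psl_in_U_dom)
  then obtain B where B: "psl A = psl B" "det B = 1" "psl W \<in> carrier PSL2" "conj2 (rep (psl W)) B $ 1 $ 1 < 0"
    by (rule U_domE[rotated]) (use assms(1) in auto)
  have "B = A \<or> B = - A" using B(1) by (auto simp: psl_eq doubleton_eq_iff)
  moreover have "rep (psl W) = W \<or> rep (psl W) = - W"
    using rep_in[OF B(3)] by (auto simp: psl_eq)
  ultimately have "Omega_m (conj2 (rep (psl W)) B) \<xi> \<eta> = Omega_m (conj2 W A) \<xi> \<eta>"
    by (auto simp: Omega_m_uminus)
  then show ?thesis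
    using Omega_eq_rep[OF B(2,3) refl B(4) assms(4,5)] by (simp add: B(1))
qed

section \<open>The flow\<close>

text \<open>The preimage in SL(2,R) is cut out by two open balls, around \<open>W\<close> and
  \<open>- W\<close>.\<close>

lemma psl_open_ball:
  fixes W :: mat2
  shows "psl_open (psl ` {V. det V = 1 \<and> dist W V < \<delta>})"
proof -
  have mem: "psl V \<in> psl ` {V. det V = 1 \<and> dist W V < \<delta>} \<longleftrightarrow> dist W V < \<delta> \<or> dist (- W) V < \<delta>"
    if "det V = 1" for V
  proof -
    have "psl V = psl V' \<longleftrightarrow> V' = V \<or> V' = - V" for V'
      by (auto simp: psl_eq doubleton_eq_iff)
    moreover have "dist W (- V) = dist (- W) V"
      by (metis dist_minus minus_minus)
    ultimately show ?thesis using that by (auto simp: image_iff intro: exI[of _ "- V"])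
  qed
  have "{V \<in> carrier SL2. psl V \<in> psl ` {V. det V = 1 \<and> dist W V < \<delta>}}
      = carrier SL2 \<inter> (ball W \<delta> \<union> ball (- W) \<delta>)"
    by (simp add: set_eq_iff mem cong: conj_cong)
  moreover have "openin (top_of_set (carrier SL2)) (carrier SL2 \<inter> (ball W \<delta> \<union> ball (- W) \<delta>))"
    by (intro openin_open_Int open_Un open_ball)
  ultimately show ?thesis by (auto simp: psl_open_def)
qed

lemma right_mult_psl: "(\<lambda>W. W ** E) ` psl V = psl (V ** E)"
  by (auto simp: psl_eq uminus_matrix_mult)

text \<open>Since \<open>W \<xi> E = (W E) (E\<^sup>-\<^sup>1 \<xi> E)\<close>, right multiplication
  acts on encoded tangent vectors by conjugation.\<close>

lemma has_tangent_map_right_mult: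
  assumes "p \<in> carrier PSL2" "det E = 1"
  shows "has_tangent_map ((`) (\<lambda>W. W ** E)) (conj2 E) p"
proof -
  have "W ** \<xi> ** E = W ** E ** conj2 E \<xi>" for W \<xi>
  proof -
    have "W ** E ** conj2 E \<xi> = W ** (E ** adj2 E) ** \<xi> ** E"
      by (simp add: conj2_def matrix_mul_assoc)
    then show ?thesis by (simp add: adj2_inverse[OF assms(2)])
  qed
  moreover have "((\<lambda>W. W ** E) has_derivative (\<lambda>H. H ** E)) F" for F :: "mat2 filter"
    by (rule bounded_linear_imp_has_derivative,
        rule bounded_bilinear.bounded_linear_left[OF bounded_bilinear_matrix_mult])
  moreover have "rep p ** E \<in> (\<lambda>W. W ** E) ` p"
    using rep_in[OF assms(1)] by blast
  ultimately show ?thesis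
    unfolding has_tangent_map_def
    by (intro bexI[OF _ rep_in[OF assms(1)]] exI[of _ "\<lambda>W. W ** E"] exI[of _ "\<lambda>H. H ** E"])
      (auto simp: right_mult_psl, simp add: psl_eq)
qed

text \<open>The upper-left entry depends continuously on starting point and time jointly, so it
  stays nonzero near \<open>(W, 0)\<close>; this gives one \<open>\<epsilon>\<close> for a whole
  neighbourhood.\<close>

lemma local_flow_right_mult:
  assumes A: "det A = 1" and W: "det W = 1" "conj2 W A $ 1 $ 1 \<noteq> 0"
    and E: "E 0 = mat 1" "\<And>t. det (E t) = 1" "\<And>t. (E has_vector_derivative E t ** \<sigma>) (at t)"
    and X: "\<And>q. q \<in> U_dom (psl A) \<Longrightarrow> X q = \<sigma>"
  obtains \<epsilon> N where "\<epsilon> > 0" "psl_open N" "psl W \<in> N"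
    "local_flow (U_dom (psl A)) X \<epsilon> N (\<lambda>t. (`) (\<lambda>V. V ** E t))"
proof -
  obtain D where D: "((\<lambda>V. conj2 V A) has_derivative D) (at W)"
    by (rule has_derivative_conj2[OF W(1), where A = A and S = UNIV])
  have cont_conj: "isCont (\<lambda>V. conj2 V A $ 1 $ 1) (W ** E 0)"
    using has_derivative_continuous[OF bounded_linear.has_derivative[OF bounded_linear_mat2_nth D]]
    by (simp add: E(1))
  have "isCont E 0" by (rule has_vector_derivative_continuous[OF E(3)])
  then have "isCont (\<lambda>x. E (snd x)) (W, 0)"
    by (intro isCont_o2[where f = snd and g = E]) simp_all
  then have "isCont (\<lambda>x. fst x ** E (snd x)) (W, 0)"
    by (intro bounded_bilinear.continuous[OF bounded_bilinear_matrix_mult]) simp_all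
  from isCont_o2[OF this, of "\<lambda>V. conj2 V A $ 1 $ 1"] cont_conj
  have "isCont (\<lambda>x. conj2 (fst x ** E (snd x)) A $ 1 $ 1) (W, 0)" by simp
  from continuous_at_avoid[OF this, of 0] W(2) E(1)
  obtain e where e: "e > 0" "\<And>V t. dist (W, 0) (V, t) < e \<Longrightarrow> conj2 (V ** E t) A $ 1 $ 1 \<noteq> 0"
    by auto
  have nz: "conj2 (V ** E t) A $ 1 $ 1 \<noteq> 0" if "dist W V < e / 2" "\<bar>t\<bar> < e / 2" for V t
  proof (rule e(2))
    have "dist (W, 0) (V, t) \<le> dist W V + \<bar>t\<bar>"
      unfolding dist_Pair_Pair using sqrt_sum_squares_le_sum_abs[of "dist W V" "dist 0 t"] by simp
    then show "dist (W, 0) (V, t) < e" using that by simp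
  qed
  let ?N = "psl ` {V. det V = 1 \<and> dist W V < e / 2}"
  show ?thesis
  proof (rule that)
    show "e / 2 > 0" "psl W \<in> ?N" using e(1) W(1) by auto
    show "psl_open ?N" by (rule psl_open_ball)
    show "local_flow (U_dom (psl A)) X (e / 2) ?N (\<lambda>t. (`) (\<lambda>V. V ** E t))"
      unfolding local_flow_def
    proof (intro ballI conjI allI impI)
      fix q assume "q \<in> ?N"
      then obtain V where V: "q = psl V" "det V = 1" "dist W V < e / 2" by auto
      show "(\<lambda>V. V ** E 0) ` q = q" by (simp add: E(1))
      fix t :: real assume t: "\<bar>t\<bar> < e / 2"
      show U: "(\<lambda>V. V ** E t) ` q \<in> U_dom (psl A)"
        using nz[OF V(3) t] V(2) A E(2) by (simp add: V(1) right_mult_psl psl_in_U_dom det_mul)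
      have mem: "W \<in> psl W" for W by (simp add: psl_eq)
      have "((\<lambda>s. V ** E s) has_vector_derivative V ** (E t ** \<sigma>)) (at t)"
        by (rule bounded_linear.has_vector_derivative[OF
              bounded_bilinear.bounded_linear_right[OF bounded_bilinear_matrix_mult] E(3)])
      then show "has_velocity (\<lambda>s. (\<lambda>V. V ** E s) ` q) (X ((\<lambda>V. V ** E t) ` q)) t"
        unfolding has_velocity_def
        by (intro exI[of _ "\<lambda>s. V ** E s"])
          (simp add: X[OF U[unfolded V(1) right_mult_psl]] matrix_mul_assoc V(1) right_mult_psl mem)
    qed
  qed
qed

text \<open>In the first term everything is conjugated by the same \<open>E\<close>, which the trace
  ignores; only \<open>trace_log_form\<close> retains a dependence on \<open>E\<close>.\<close>

lemma Omega_right_mult: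
  assumes A: "det A = 1" and W: "det W = 1" and E: "det E = 1"
    and nz: "conj2 (W ** E) A $ 1 $ 1 \<noteq> 0" and "\<xi> \<in> sl2" "\<eta> \<in> sl2"
  defines "m \<equiv> conj2 W A"
  shows "Omega k (psl A) (psl (W ** E)) (conj2 E \<xi>) (conj2 E \<eta>) = k / (8 * pi) *
    (trace (\<xi> ** m ** \<eta> ** adj2 m) - trace (\<eta> ** m ** \<xi> ** adj2 m)
      + trace_log_form (conj2 E m) (conj2 E (comm2 m \<xi>)) (conj2 E (comm2 m \<eta>)))"
proof -
  have "Omega k (psl A) (psl (W ** E)) (conj2 E \<xi>) (conj2 E \<eta>)
      = k / (8 * pi) * Omega_m (conj2 E m) (conj2 E \<xi>) (conj2 E \<eta>)"
    using Omega_eq[OF A _ nz, of "conj2 E \<xi>" "conj2 E \<eta>" k] assms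
    by (simp add: det_mul conj2_sl2 conj2_conj2)
  then show ?thesis
    by (simp add: Omega_m_def adj2_conj2 conj2_mult[OF E, symmetric] trace_conj2[OF E] conj2_comm2[OF E])
qed

theorem mainTheorem1:
  fixes k :: real and M :: "mat2 set" and \<sigma> :: mat2 and X :: "mat2 set \<Rightarrow> mat2"
  assumes "k \<noteq> 0"
    and "M \<in> carrier PSL2"
    and "\<sigma> \<in> sl2"
    and X_sl2: "\<forall>p\<in>U_dom M. X p \<in> sl2"
    and X_W0: "\<forall>p\<in>U_dom M. \<forall>W\<in>p. delta_lift (\<lambda>W0. W0) W p (X p) = (2 * pi / k) *\<^sub>R (W ** \<sigma>)"
  shows "\<forall>p\<in>U_dom M.
      (\<forall>\<eta>\<in>sl2.
         interior2 X (Omega k M) p \<eta>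
           = - tr (matrix_inv (m_minus M p) ** ext_d (m_minus M) p \<eta> ** \<sigma>)
             + tr (matrix_inv (m_plus M p) ** ext_d (m_plus M) p \<eta> ** \<sigma>)
       \<and> - tr (matrix_inv (m_minus M p) ** ext_d (m_minus M) p \<eta> ** \<sigma>)
             + tr (matrix_inv (m_plus M p) ** ext_d (m_plus M) p \<eta> ** \<sigma>)
           = pairing (- left_log_pair (Q_map M) p \<eta>) \<sigma>)
    \<and> has_lie_derivative2 (U_dom M) X (Omega k M) p
        (\<lambda>\<xi> \<eta>. pairing (wedge_pair (left_log_pair (Q_map M)) (left_log_pair (Q_map M)) p \<xi> \<eta>) \<sigma>)"
proof (rule ballI)
  fix p assume pU: "p \<in> U_dom M"
  obtain A where A: "M = psl A" "det A = 1" and p: "p \<in> carrier PSL2"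
    and neg: "conj2 (rep p) A $ 1 $ 1 < 0"
    by (rule U_domE[OF assms(2) pU])
  define W where "W = rep p"
  define m where "m = conj2 W A"
  define \<tau> where "\<tau> = (2 * pi / k) *\<^sub>R \<sigma>"
  have \<tau>: "\<tau> \<in> sl2" using assms(3) by (simp add: \<tau>_def sl2_iff)
  have W: "det W = 1" "p = psl W" using PSL2_memD[OF p rep_in[OF p]] by (auto simp: W_def)
  have m: "m = conj2 (rep p) A" "m $ 1 $ 1 < 0" "m $ 1 $ 1 \<noteq> 0" "det m = 1"
    using neg A(2) W(1) by (auto simp: m_def W_def det_conj2)
  note base = A(2) p m(1,2)
  \<comment> \<open>The lift cancels on the left of the defining equation, so in this encoding
    \<open>X\<close> is a constant field.\<close>
  have X: "X q = \<tau>" if q: "q \<in> U_dom M" for q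
  proof -
    have qc: "q \<in> carrier PSL2" using q by (simp add: U_dom_def)
    have "rep q ** X q = (2 * pi / k) *\<^sub>R (rep q ** \<sigma>)"
      using bspec[OF bspec[OF X_W0 q] rep_in[OF qc]]
      by (simp add: delta_lift_def left_log_id[OF qc bspec[OF X_sl2 q]])
    then have "rep q ** X q = rep q ** \<tau>" by (simp add: \<tau>_def scaleR_matrix_mult)
    then show ?thesis by (rule SL2_cancel_left[OF PSL2_memD(1)[OF qc rep_in[OF qc]]])
  qed
  let ?Lp = "\<lambda>\<xi>. log_plus m (comm2 m \<xi>)" and ?Lm = "\<lambda>\<xi>. log_minus m (comm2 m \<xi>)"
  have left_log: "left_log_pair (Q_map M) p \<xi> = (?Lm \<xi>, ?Lp \<xi>)" if "\<xi> \<in> sl2" for \<xi>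
    unfolding A(1) by (rule left_log_pair_Q_map[OF base that])
  have inv_d: "matrix_inv (m_plus M p) ** ext_d (m_plus M) p \<xi> = ?Lp \<xi>"
    "matrix_inv (m_minus M p) ** ext_d (m_minus M) p \<xi> = ?Lm \<xi>" if "\<xi> \<in> sl2" for \<xi>
    unfolding A(1) using det_m_pm_at[OF base]
    by (simp_all add: ext_d_m_pm[OF base that] matrix_inv_det_1 matrix_mul_assoc adj2_inverse)
  have interior: "interior2 X (Omega k M) p \<eta> = - tr (?Lm \<eta> ** \<sigma>) + tr (?Lp \<eta> ** \<sigma>)"
    if \<eta>: "\<eta> \<in> sl2" for \<eta>
  proof -
    have "interior2 X (Omega k M) p \<eta> = k / (8 * pi) * (2 * trace ((?Lp \<eta> - ?Lm \<eta>) ** \<tau>))"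
      unfolding interior2_def X[OF pU] A(1)
      by (simp add: Omega_eq_rep[OF base \<tau> \<eta>] Omega_m_interior[OF m(3,4) \<tau> \<eta>])
    \<comment> \<open>The constants combine to 1/2, which is the normalization of
      \<open>tr\<close>.\<close>
    also have "\<dots> = trace ((?Lp \<eta> - ?Lm \<eta>) ** \<sigma>) / 2"
      using assms(1) by (simp add: \<tau>_def trace_2 matrix_mult_nth2 field_simps)
    finally show ?thesis by (simp add: tr_def trace_2 matrix_mult_nth2 field_simps)
  qed
  have pairing: "- tr (?Lm \<eta> ** \<sigma>) + tr (?Lp \<eta> ** \<sigma>) = pairing (- left_log_pair (Q_map M) p \<eta>) \<sigma>"
    if "\<eta> \<in> sl2" for \<eta>
    by (simp add: left_log[OF that] pairing_def tr_def trace_2 matrix_mult_nth2 field_simps)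
  have "has_lie_derivative2 (U_dom M) X (Omega k M) p
    (\<lambda>\<xi> \<eta>. pairing (wedge_pair (left_log_pair (Q_map M)) (left_log_pair (Q_map M)) p \<xi> \<eta>) \<sigma>)"
  proof -
    obtain E where E: "E 0 = mat 1" "\<And>t. det (E t) = 1"
      "\<And>t. (E has_vector_derivative E t ** \<tau>) (at t)" "\<And>t. E t ** \<tau> = \<tau> ** E t"
      by (rule one_parameter_subgroup[OF \<tau>]) (rule that)
    have E': "(E has_vector_derivative \<tau>) (at 0)" using E(3)[of 0] E(1) by simp
    have nz: "conj2 W A $ 1 $ 1 \<noteq> 0" using m(3) by (simp add: m_def)
    obtain \<epsilon> N where N': "\<epsilon> > 0" "psl_open N" "psl W \<in> N"
      and flow': "local_flow (U_dom (psl A)) X \<epsilon> N (\<lambda>t. (`) (\<lambda>V. V ** E t))"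
      by (rule local_flow_right_mult[where X = X, OF A(2) W(1) nz E(1,2,3) X[unfolded A(1)]]) (assumption, rule that)
    note N = N'[folded W(2)] and flow = flow'[folded A(1)]
    have "((\<lambda>t. Omega k M ((\<lambda>V. V ** E t) ` p) (conj2 (E t) \<xi>) (conj2 (E t) \<eta>)) has_real_derivative
        pairing (wedge_pair (left_log_pair (Q_map M)) (left_log_pair (Q_map M)) p \<xi> \<eta>) \<sigma>) (at 0)"
      if \<xi>: "\<xi> \<in> sl2" and \<eta>: "\<eta> \<in> sl2" for \<xi> \<eta>
    proof -
      let ?c = "trace (\<xi> ** m ** \<eta> ** adj2 m) - trace (\<eta> ** m ** \<xi> ** adj2 m)"
      let ?B = "comm2 (?Lp \<xi>) (?Lp \<eta>) - comm2 (?Lm \<xi>) (?Lm \<eta>)"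
      \<comment> \<open>The formula for the 2-form holds while the flow stays in
        \<open>U_dom M\<close>; times below \<open>\<epsilon>\<close> suffice for the derivative at
        0.\<close>
      have eq: "k / (8 * pi) * (?c + trace_log_form (conj2 (E t) m) (conj2 (E t) (comm2 m \<xi>)) (conj2 (E t) (comm2 m \<eta>)))
          = Omega k M ((\<lambda>V. V ** E t) ` p) (conj2 (E t) \<xi>) (conj2 (E t) \<eta>)"
        if "t \<in> {- \<epsilon><..<\<epsilon>}" for t
      proof -
        have "(\<lambda>V. V ** E t) ` p \<in> U_dom M"
          using flow N(3) that by (auto simp: local_flow_def)
        then have "conj2 (W ** E t) A $ 1 $ 1 \<noteq> 0"
          using A W E(2) by (simp add: right_mult_psl psl_in_U_dom det_mul)
        from Omega_right_mult[OF A(2) W(1) E(2) this \<xi> \<eta>] show ?thesis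
          by (simp add: A(1) W(2) right_mult_psl m_def)
      qed
      have "((\<lambda>t. k / (8 * pi) * (?c + trace_log_form (conj2 (E t) m) (conj2 (E t) (comm2 m \<xi>)) (conj2 (E t) (comm2 m \<eta>))))
          has_real_derivative k / (8 * pi) * (0 + - 2 * trace (?B ** \<tau>))) (at 0)"
        by (intro DERIV_cmult DERIV_add DERIV_const trace_log_form_derivative[OF m(3,4) \<tau> \<xi> \<eta> E(1) E'])
      then have "((\<lambda>t. Omega k M ((\<lambda>V. V ** E t) ` p) (conj2 (E t) \<xi>) (conj2 (E t) \<eta>))
          has_real_derivative k / (8 * pi) * (0 + - 2 * trace (?B ** \<tau>))) (at 0)"
        by (rule has_field_derivative_transform_within_open[where S = "{- \<epsilon><..<\<epsilon>}"])
          (use N(1) eq in auto)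
      moreover have "k / (8 * pi) * (0 + - 2 * trace (?B ** \<tau>)) = - tr (?B ** \<sigma>)"
        using assms(1) by (simp add: \<tau>_def scaleR_matrix_mult tr_def trace_2 field_simps)
      \<comment> \<open>The square of a matrix-valued 1-form takes as value the commutator of its
        two values.\<close>
      moreover have "pairing (wedge_pair (left_log_pair (Q_map M)) (left_log_pair (Q_map M)) p \<xi> \<eta>) \<sigma>
          = - tr (?B ** \<sigma>)"
        by (simp add: pairing_def wedge_pair_def wedge_def left_log \<xi> \<eta> comm2_def)
      ultimately show ?thesis by simp
    qed
    then show ?thesis
      unfolding has_lie_derivative2_def
      using N flow has_tangent_map_right_mult[OF p E(2)]
      by (intro exI[of _ \<epsilon>] exI[of _ N] exI[of _ "\<lambda>t. (`) (\<lambda>V. V ** E t)"] exI[of _ "\<lambda>t. conj2 (E t)"]) blast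
  qed
  then show "(\<forall>\<eta>\<in>sl2.
         interior2 X (Omega k M) p \<eta>
           = - tr (matrix_inv (m_minus M p) ** ext_d (m_minus M) p \<eta> ** \<sigma>)
             + tr (matrix_inv (m_plus M p) ** ext_d (m_plus M) p \<eta> ** \<sigma>)
       \<and> - tr (matrix_inv (m_minus M p) ** ext_d (m_minus M) p \<eta> ** \<sigma>)
             + tr (matrix_inv (m_plus M p) ** ext_d (m_plus M) p \<eta> ** \<sigma>)
           = pairing (- left_log_pair (Q_map M) p \<eta>) \<sigma>)
    \<and> has_lie_derivative2 (U_dom M) X (Omega k M) p
        (\<lambda>\<xi> \<eta>. pairing (wedge_pair (left_log_pair (Q_map M)) (left_log_pair (Q_map M)) p \<xi> \<eta>) \<sigma>)"
    by (simp add: inv_d interior pairing[symmetric])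
qed

end
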